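(* Let $\kappa>0$, $R>0$, and let $\boldsymbol J\in H(\mathrm{div};\mathrm{grad};B_R)$ be a source with compact support contained in $B_R$. Put $\boldsymbol{\mathcal J}(x)=\boldsymbol J(x)+\kappa^{-2}\nabla(\nabla\cdot\boldsymbol J(x))$ and let $\hat{\boldsymbol{\mathcal J}}(\xi)=\int_{B_R}\boldsymbol{\mathcal J}(x)e^{-\mathrm i\xi\cdot x}\,\mathrm dx$ be its Fourier transform. Then $\boldsymbol J$ is nonradiating if and only if $\hat{\boldsymbol{\mathcal J}}(\xi)=0$ for all $\xi\in\mathbb R^3$ with $|\xi|=\kappa$.
   Context: $B_R=\{x\in\mathbb R^3:|x|<R\}$, $\kappa>0$ is the wavenumber, $g(x,y)=\frac{e^{\mathrm i\kappa|x-y|}}{4\pi|x-y|}$, and $\boldsymbol G(x,y)=[\boldsymbol I+\kappa^{-2}\nabla\nabla]g(x,y)$ is the $3\times3$ dyadic Green's tensor of Maxwell's equations ($\nabla\nabla$ is the Hessian). The electric field generated by $\boldsymbol J$ is $\boldsymbol E(x)=\int_{B_R}\boldsymbol G(x,y)\boldsymbol J(y)\,\mathrm dy$, the solution of $\nabla\times(\nabla\times\boldsymbol E)-\kappa^2\boldsymbol E=\boldsymbol J$ satisfying the Silver--Müller radiation condition. A source $\boldsymbol J$ with compact support contained in $B_R$ is called nonradiating if this $\boldsymbol E$ is identically zero outside $B_R$. $H(\mathrm{div};\mathrm{grad};B_R)=\{\boldsymbol\Psi\in(L^2(B_R))^3:\nabla(\nabla\cdot\boldsymbol\Psi)\in(L^2(B_R))^3\}$.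 *)

theory Defs
  imports "HOL-Analysis.Analysis"
begin

section \<open>Test functions\<close>

definition partial_deriv :: "3 \<Rightarrow> (real^3 \<Rightarrow> complex) \<Rightarrow> real^3 \<Rightarrow> complex" where
  "partial_deriv i f x = vector_derivative (\<lambda>t. f (x + t *\<^sub>R axis i 1)) (at 0)"

text \<open>Requiring every iterated partial derivative (including \<open>f\<close> itself, for the empty list)
  to be Frechet differentiable everywhere is the usual notion of a smooth function.\<close>

definition smooth :: "(real^3 \<Rightarrow> complex) \<Rightarrow> bool" where
  "smooth f \<longleftrightarrow> (\<forall>is. foldr partial_deriv is f differentiable_on UNIV)"

definition test_functions :: "(real^3) set \<Rightarrow> (real^3 \<Rightarrow> complex) set" where
  "test_functions \<Omega> =
     {\<phi>. smooth \<phi> \<and> compact (closure {x. \<phi> x \<noteq> 0}) \<and> closure {x. \<phi> x \<noteq> 0} \<subseteq> \<Omega>}"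

section \<open>The space of fields with square-integrable gradient of the divergence\<close>

text \<open>Elements of $L^2$ are represented by functions on the whole space; only their values in
  \<open>\<Omega>\<close>, up to null sets, matter in all of the definitions below.\<close>

definition L2 :: "(real^3) set \<Rightarrow> (real^3 \<Rightarrow> complex^3) set" where
  "L2 \<Omega> = {f. f \<in> borel_measurable (lebesgue_on \<Omega>) \<and>
              integrable (lebesgue_on \<Omega>) (\<lambda>x. (norm (f x))\<^sup>2)}"

text \<open>Distributions are linear functionals on test functions; a locally integrable function
  acts by the bilinear pairing (without conjugation), and derivatives are moved to the
  test function with a change of sign.\<close>

definition distr_div :: "(real^3) set \<Rightarrow> (real^3 \<Rightarrow> complex^3) \<Rightarrow> (real^3 \<Rightarrow> complex) \<Rightarrow> complex" where
  "distr_div \<Omega> \<Psi> \<phi> = - (LINT x|lebesgue_on \<Omega>. (\<Sum>j\<in>UNIV. \<Psi> x $ j * partial_deriv j \<phi> x))"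

definition distr_grad ::
    "((real^3 \<Rightarrow> complex) \<Rightarrow> complex) \<Rightarrow> 3 \<Rightarrow> (real^3 \<Rightarrow> complex) \<Rightarrow> complex" where
  "distr_grad T i \<phi> = - T (partial_deriv i \<phi>)"

definition is_grad_div :: "(real^3) set \<Rightarrow> (real^3 \<Rightarrow> complex^3) \<Rightarrow> (real^3 \<Rightarrow> complex^3) \<Rightarrow> bool" where
  "is_grad_div \<Omega> \<Psi> F \<longleftrightarrow>
     (\<forall>\<phi>\<in>test_functions \<Omega>. \<forall>i.
        distr_grad (distr_div \<Omega> \<Psi>) i \<phi> = (LINT x|lebesgue_on \<Omega>. F x $ i * \<phi> x))"

definition H_div_grad :: "(real^3) set \<Rightarrow> (real^3 \<Rightarrow> complex^3) set" where
  "H_div_grad \<Omega> = {\<Psi>. \<Psi> \<in> L2 \<Omega> \<and> (\<exists>F\<in>L2 \<Omega>. is_grad_div \<Omega> \<Psi> F)}"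

text \<open>For \<open>\<Psi> \<in> H_div_grad \<Omega>\<close> with \<open>\<Omega>\<close> open, the representative chosen here is unique up to
  a null subset of \<open>\<Omega>\<close>.\<close>

definition grad_div :: "(real^3) set \<Rightarrow> (real^3 \<Rightarrow> complex^3) \<Rightarrow> real^3 \<Rightarrow> complex^3" where
  "grad_div \<Omega> \<Psi> = (SOME F. F \<in> L2 \<Omega> \<and> is_grad_div \<Omega> \<Psi> F)"

text \<open>The support of a function in $L^2$, i.e. of the corresponding distribution on \<open>\<Omega>\<close>. It is
  closed relative to \<open>\<Omega>\<close>, so for open \<open>\<Omega>\<close> compactness keeps it away from the boundary.\<close>

definition ess_support :: "(real^3) set \<Rightarrow> (real^3 \<Rightarrow> complex^3) \<Rightarrow> (real^3) set" where
  "ess_support \<Omega> f =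
     \<Omega> - \<Union>{U. open U \<and> (AE x in lebesgue. x \<in> \<Omega> \<inter> U \<longrightarrow> f x = 0)}"

section \<open>Electric field of a source\<close>

definition green :: "real \<Rightarrow> real^3 \<Rightarrow> real^3 \<Rightarrow> complex" where
  "green \<kappa> x y = exp (\<i> * of_real (\<kappa> * norm (x - y))) / of_real (4 * pi * norm (x - y))"

definition hessian :: "(real^3 \<Rightarrow> complex) \<Rightarrow> real^3 \<Rightarrow> complex^3^3" where
  "hessian f x = (\<chi> i j. partial_deriv i (partial_deriv j f) x)"

definition green_tensor :: "real \<Rightarrow> real^3 \<Rightarrow> real^3 \<Rightarrow> complex^3^3" where
  "green_tensor \<kappa> x y =
     mat (green \<kappa> x y) + (1 / \<kappa>\<^sup>2) *\<^sub>R hessian (\<lambda>z. green \<kappa> z y) x"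

text \<open>The integral is used below only at points \<open>x\<close> outside the ball. There the kernel is
  bounded on the compact support of \<open>J\<close>, so it is an ordinary Lebesgue integral.\<close>

definition electric_field :: "real \<Rightarrow> real \<Rightarrow> (real^3 \<Rightarrow> complex^3) \<Rightarrow> real^3 \<Rightarrow> complex^3" where
  "electric_field \<kappa> R J x = (LINT y|lebesgue_on (ball 0 R). green_tensor \<kappa> x y *v J y)"

definition nonradiating :: "real \<Rightarrow> real \<Rightarrow> (real^3 \<Rightarrow> complex^3) \<Rightarrow> bool" where
  "nonradiating \<kappa> R J \<longleftrightarrow> (\<forall>x. x \<notin> ball 0 R \<longrightarrow> electric_field \<kappa> R J x = 0)"

section \<open>Modified source and Fourier transform\<close>

definition modified_source ::
    "real \<Rightarrow> real \<Rightarrow> (real^3 \<Rightarrow> complex^3) \<Rightarrow> real^3 \<Rightarrow> complex^3" where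
  "modified_source \<kappa> R J x = J x + (1 / \<kappa>\<^sup>2) *\<^sub>R grad_div (ball 0 R) J x"

definition fourier_ball :: "real \<Rightarrow> (real^3 \<Rightarrow> complex^3) \<Rightarrow> real^3 \<Rightarrow> complex^3" where
  "fourier_ball R f \<xi> = (LINT x|lebesgue_on (ball 0 R). exp (- \<i> * of_real (\<xi> \<bullet> x)) *s f x)"

end

theory Submission
  imports Defs "HOL-Complex_Analysis.Conformal_Mappings" "HOL-Real_Asymp.Real_Asymp"
begin

text \<open>Why the theorem holds. The weak definition of \<open>\<nabla>(\<nabla>\<cdot>J)\<close> lets both derivatives be moved from the
  source onto a smooth kernel \<open>\<phi>\<close>: \<open>\<integral> (\<nabla>(\<nabla>\<cdot>J))\<^sub>i \<phi> = \<integral> \<Sum>\<^sub>j J\<^sub>j \<partial>\<^sub>j\<partial>\<^sub>i\<phi>\<close>. Since \<open>J\<close> vanishes near the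
  boundary, \<open>\<phi>\<close> may first be multiplied by a cutoff \<open>\<chi>\<close> that is \<open>1\<close> near the support of \<open>J\<close>, which turns it
  into a test function. With \<open>\<phi>\<close> the scalar Green's function \<open>g(c,\<cdot>)\<close>, respectively a plane wave, this shows
  that, with \<open>f\<^sub>i = \<chi>(J + \<kappa>\<^sup>-\<^sup>2\<nabla>(\<nabla>\<cdot>J))\<^sub>i\<close>, the \<open>i\<close>-th component of the electric field at a point \<open>c\<close> outside
  the ball is \<open>\<integral> g(c,y) f\<^sub>i(y) dy\<close> (\<open>electric_field_component\<close>), and the \<open>i\<close>-th component of the Fourier
  transform of the modified source is the Fourier transform of \<open>f\<^sub>i\<close> (\<open>fourier_component\<close>). What remains is a
  statement about one scalar integrable \<open>f\<close> that vanishes outside a smaller ball: its outgoing Helmholtz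
  field vanishes outside the ball if and only if its Fourier transform vanishes on the sphere \<open>|\<xi>| = \<kappa>\<close>.

  If the field vanishes far away, so does its far-field pattern, the limit of
  \<open>4\<pi>t e\<^sup>-\<^sup>i\<^sup>\<kappa>\<^sup>t\<close> times the field at \<open>t n\<close> as \<open>t \<rightarrow> \<infinity>\<close>, and this limit is the Fourier transform
  of \<open>f\<close> at \<open>\<kappa> n\<close> (\<open>Fourier_zero_if_outgoing_field_zero\<close>).

  For the converse, the Fourier transform of \<open>f\<close> extends to an entire function of \<open>\<zeta> \<in> \<complex>\<^sup>3\<close>. The set
  \<open>\<zeta>\<cdot>\<zeta> = \<kappa>\<^sup>2\<close> is swept out by the complex curves \<open>z \<mapsto> \<kappa>(a cos z + b sin z)\<close> with \<open>a, b\<close> orthonormal, along each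
  of which the transform is entire and vanishes for real \<open>z\<close>; hence it vanishes on the whole complex sphere
  (\<open>complexified_Fourier_zero\<close>). It then suffices to write a spherical wave centred at \<open>x\<close>, in the half-space
  \<open>y\<cdot>x < |x|\<^sup>2\<close>, as an absolutely convergent superposition of plane waves \<open>e\<^sup>i\<^sup>\<zeta>\<^sup>\<cdot>\<^sup>y\<close> with \<open>\<zeta>\<cdot>\<zeta> = \<kappa>\<^sup>2\<close>. Such a
  formula, a variant of Weyl's plane wave expansion, is \<open>spherical_wave_superposition\<close>; it comes from one
  Laplace integral and one application of Cauchy's integral formula on the unit circle. By Fubini's theorem
  the field at every \<open>x\<close> outside the ball is a superposition of zeros
  (\<open>outgoing_field_zero_if_Fourier_zero\<close>).\<close>

section \<open>A contour integral behind the plane wave expansion\<close>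

abbreviation half_line :: "real measure" where
  "half_line \<equiv> restrict_space lborel {0..}"

abbreviation unit_interval :: "real measure" where
  "unit_interval \<equiv> restrict_space lborel {0..1}"

lemma sigma_finite_half_line: "sigma_finite_measure half_line"
  by (rule sigma_finite_measure_restrict_space) (auto simp: lborel.sigma_finite_measure_axioms)

lemma finite_unit_interval: "finite_measure unit_interval"
  by (rule finite_measureI) (simp add: emeasure_restrict_space)

lemma integrable_exp_half_line:
  fixes c :: real
  assumes "c > 0"
  shows "integrable half_line (\<lambda>s. exp (- (c * s)))"
proof -
  have "((\<lambda>x. - exp (- (c * x)) / c) \<longlongrightarrow> 0) at_top"
    using assms by real_asymp
  then have "(\<integral>\<^sup>+x. ennreal (exp (- (c * x))) * indicator {0..} x \<partial>lborel) = 0 - (- exp (- (c * 0)) / c)"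
    using assms by (intro nn_integral_FTC_atLeast) (auto intro!: derivative_eq_intros)
  then have fin: "(\<integral>\<^sup>+x. ennreal (exp (- (c * x))) * indicator {0..} x \<partial>lborel) < \<infinity>"
    by simp
  show ?thesis
  proof (rule integrableI_nonneg)
    show "(\<integral>\<^sup>+x. ennreal (exp (- (c * x))) \<partial>half_line) < \<infinity>"
      using fin by (simp add: nn_integral_restrict_space)
  qed (auto intro!: measurable_restrict_space1)
qed

lemma laplace_integral_exp:
  fixes z :: complex
  assumes "Re z > 0"
  shows "(LINT s|half_line. exp (- (z * of_real s))) = 1 / z"
proof -
  have int: "integrable half_line (\<lambda>s. exp (- (z * of_real s)))"
    by (rule Bochner_Integration.integrable_bound[OF integrable_exp_half_line[OF assms]])
      (auto intro!: measurable_restrict_space1 simp: norm_exp_eq_Re)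
  have z0: "z \<noteq> 0" using assms by auto
  have "set_integrable lborel {0..} (\<lambda>s. exp (- (z * of_real s)))"
    using int unfolding set_integrable_def by (subst (asm) integrable_restrict_space) auto
  then have lim: "((\<lambda>b. LINT s:{0..b}|lborel. exp (- (z * of_real s))) \<longlongrightarrow>
      (LINT s:{0..}|lborel. exp (- (z * of_real s)))) at_top"
    by (intro tendsto_set_lebesgue_integral_at_top) auto
  have val: "(LINT s:{0..b}|lborel. exp (- (z * of_real s))) = (1 - exp (- (z * of_real b))) / z"
    if "b \<ge> 0" for b
  proof -
    have "has_bochner_integral lborel (\<lambda>x. indicator {0..b} x *\<^sub>R exp (- (z * of_real x)))
       ((- exp (- (z * of_real b)) / z) - (- exp (- (z * of_real 0)) / z))"
      using that z0
    proof (intro has_bochner_integral_FTC_Icc)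
      show "((\<lambda>x. - exp (- (z * of_real x)) / z) has_vector_derivative exp (- (z * of_real x))) (at x within {0..b})"
        for x :: real
        by (rule has_vector_derivative_real_field) (use z0 in \<open>auto intro!: derivative_eq_intros\<close>)
    qed (auto intro!: continuous_intros)
    then show ?thesis
      unfolding set_lebesgue_integral_def
      by (simp add: has_bochner_integral_integral_eq diff_divide_distrib)
  qed
  have "((\<lambda>b::real. norm (exp (- (z * of_real b)))) \<longlongrightarrow> 0) at_top"
    unfolding norm_exp_eq_Re using assms by simp real_asymp
  then have "((\<lambda>b::real. exp (- (z * of_real b))) \<longlongrightarrow> 0) at_top"
    by (rule tendsto_norm_zero_cancel)
  then have "((\<lambda>b::real. (1 - exp (- (z * of_real b))) / z) \<longlongrightarrow> (1 - 0) / z) at_top"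
    by (intro tendsto_intros z0)
  then have "((\<lambda>b::real. (1 - exp (- (z * of_real b))) / z) \<longlongrightarrow> 1 / z) at_top"
    by simp
  then have "((\<lambda>b. LINT s:{0..b}|lborel. exp (- (z * of_real s))) \<longlongrightarrow> 1 / z) at_top"
    by (rule Lim_transform_eventually)
      (auto intro!: eventually_mono[OF eventually_ge_at_top[of 0]] simp: val)
  with lim have "(LINT s:{0..}|lborel. exp (- (z * of_real s))) = 1 / z"
    using tendsto_unique trivial_limit_at_top_linorder by blast
  then show ?thesis
    unfolding set_lebesgue_integral_def by (subst integral_restrict_space) auto
qed

text \<open>On the unit circle \<open>u = e\<^sup>2\<^sup>\<pi>\<^sup>i\<^sup>t\<close> the denominator times \<open>2u\<close> is the quadratic
  \<open>v\<^sup>* u\<^sup>2 + 2 a u - v = (u - w)(v\<^sup>* u + a + S)\<close>, with \<open>v\<^sup>*\<close> the conjugate of \<open>v\<close>, which has exactly one root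
  \<open>w\<close> inside the circle. Cauchy's formula evaluates the average as a residue at \<open>w\<close>, where \<open>v\<^sup>* w = S - a\<close>.
  In the application \<open>a\<close> is the distance along an axis, \<open>|v|\<close> the distance from the axis, and thus \<open>S\<close> the
  distance of two points.\<close>

lemma circle_average:
  fixes v :: complex and a k :: real
  assumes "a > 0"
  defines "S \<equiv> sqrt (a\<^sup>2 + (norm v)\<^sup>2)"
  shows "(LINT t|unit_interval. exp (\<i> * k * (cnj v * cis (2*pi*t))) /
            (a - (v * cnj (cis (2*pi*t)) - cnj v * cis (2*pi*t)) / 2)) = exp (\<i> * k * (S - a)) / S"
    (is "(LINT t|_. ?h t) = _")
proof -
  have S: "S > 0" "S\<^sup>2 = a\<^sup>2 + (norm v)\<^sup>2" "norm v < S"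
    using assms by (auto simp: S_def add_pos_nonneg intro!: real_less_rsqrt)
  \<comment> \<open>The root is written with \<open>a + S > 0\<close> in the denominator so that \<open>v = 0\<close> is no special case.\<close>
  define w where "w = v / (a + S)"
  define F where "F = (\<lambda>u. 2 * exp (\<i> * k * (cnj v * u)) / (cnj v * u + a + S))"
  have den: "cnj v * u + a + S \<noteq> 0" if "norm u \<le> 1" for u
  proof
    assume "cnj v * u + a + S = 0"
    then have "norm (cnj v * u) = norm (complex_of_real (a + S))"
      by (metis (no_types, opaque_lifting) add.assoc add_eq_0_iff norm_minus_cancel of_real_add)
    also have "\<dots> = a + S" using assms S by (simp only: norm_of_real)
    finally have "norm v * norm u = a + S" by (simp add: norm_mult)
    moreover have "norm v * norm u \<le> norm v * 1" using that by (intro mult_left_mono) auto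
    ultimately show False using S assms(1) by linarith
  qed
  have aS: "complex_of_real a + complex_of_real S \<noteq> 0"
    using S assms(1) by (metis add_pos_pos of_real_add of_real_eq_0_iff less_irrefl)
  have w1: "norm w < 1"
  proof -
    have "norm w = norm v / (a + S)"
      unfolding w_def norm_divide using S assms(1) by (metis abs_of_pos add_pos_pos norm_of_real of_real_add)
    then show ?thesis using S(1,3) assms(1) by (simp add: divide_less_eq)
  qed
  have vw: "cnj v * w = S - a"
  proof -
    have "cnj v * v = complex_of_real ((S - a) * (a + S))"
      using S(2) by (simp add: complex_norm_square[symmetric] mult.commute[of "cnj v"] algebra_simps power2_eq_square
          flip: of_real_mult of_real_power)
    then show ?thesis unfolding w_def using aS by (simp add: divide_simps)
  qed
  have aw: "w * (a + S) = v" unfolding w_def using aS by simp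
  have "F holomorphic_on cball 0 1"
    unfolding F_def using den by (intro holomorphic_intros) auto
  then have "((\<lambda>u. F u / (u - w)) has_contour_integral (2 * of_real pi * \<i> * F w)) (circlepath 0 1)"
    using w1 by (intro Cauchy_integral_circlepath_simple) auto
  then have "((\<lambda>t. F (circlepath 0 1 t) / (circlepath 0 1 t - w) *
        vector_derivative (circlepath 0 1) (at t within {0..1})) has_integral (2 * of_real pi * \<i> * F w)) {0..1}"
    unfolding has_contour_integral_def .
  then have "((\<lambda>t. (2 * of_real pi * \<i>) * ?h t) has_integral (2 * of_real pi * \<i>) * F w) {0..1}"
  proof (rule has_integral_eq[rotated])
    fix t :: real assume t: "t \<in> {0..1}"
    define u where "u = cis (2*pi*t)"
    have u: "norm u = 1" "u \<noteq> 0" "u * cnj u = 1" by (simp_all add: u_def flip: complex_norm_square)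
    have cu: "circlepath 0 1 t = u" by (simp add: circlepath u_def cis_conv_exp mult_ac)
    have vd: "vector_derivative (circlepath 0 1) (at t within {0..1}) = 2 * of_real pi * \<i> * u"
      using t by (simp add: vector_derivative_circlepath01 u_def cis_conv_exp mult_ac)
    have fac: "(u - w) * (cnj v * u + a + S) = 2 * u * (a - (v * cnj u - cnj v * u) / 2)"
    proof -
      have "(u - w) * (cnj v * u + a + S) = cnj v * u^2 + u * (a + S) - u * (cnj v * w) - w * (a + S)"
        by (simp add: algebra_simps power2_eq_square)
      also have "\<dots> = cnj v * u^2 + u * (a + S) - u * complex_of_real (S - a) - v" by (simp only: vw aw)
      also have "\<dots> = cnj v * u^2 + 2 * a * u - v" by (simp add: algebra_simps)
      also have "\<dots> = cnj v * u^2 + 2 * a * u - v * (u * cnj u)" by (simp add: u)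
      also have "\<dots> = 2 * u * (a - (v * cnj u - cnj v * u) / 2)"
        by (simp add: field_simps power2_eq_square)
      finally show ?thesis .
    qed
    have nz: "u - w \<noteq> 0" "cnj v * u + a + S \<noteq> 0" using w1 u den[of u] by auto
    then have nz2: "a - (v * cnj u - cnj v * u) / 2 \<noteq> 0"
      using fac by (metis mult_eq_0_iff)
    have cancel: "2 * e * u / (2 * u * d) = e / d" for e d
      using u(2) by simp
    have "F u / (u - w) * u = 2 * exp (\<i> * k * (cnj v * u)) * u / ((u - w) * (cnj v * u + a + S))"
      by (simp add: F_def field_simps)
    also have "\<dots> = exp (\<i> * k * (cnj v * u)) / (a - (v * cnj u - cnj v * u) / 2)"
      unfolding fac by (rule cancel)
    finally have eq: "F u / (u - w) * u = exp (\<i> * k * (cnj v * u)) / (a - (v * cnj u - cnj v * u) / 2)" .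
    show "F (circlepath 0 1 t) / (circlepath 0 1 t - w) *
        vector_derivative (circlepath 0 1) (at t within {0..1}) = (2 * of_real pi * \<i>) * ?h t"
      unfolding cu vd u_def[symmetric] eq[symmetric] by (simp only: mult_ac)
  qed
  then have hi: "(?h has_integral F w) {0..1}"
    by (subst (asm) has_integral_mult_right_iff) (auto simp: )
  have nz: "a - (v * cnj (cis s) - cnj v * cis s) / 2 \<noteq> 0" for s
  proof -
    have "v * cnj (cis s) - cnj v * cis s = (v * cnj (cis s)) - cnj (v * cnj (cis s))" by simp
    then have "Re (a - (v * cnj (cis s) - cnj v * cis s) / 2) = a" by simp
    then show ?thesis using assms by force
  qed
  have "continuous_on {0..1} ?h"
    using nz by (intro continuous_intros continuous_on_cis) auto
  then have "set_integrable lborel {0..1} ?h"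
    unfolding set_integrable_def by (intro borel_integrable_compact) auto
  then have "(LINT t:{0..1}|lborel. ?h t) = integral {0..1} ?h"
    by (rule set_borel_integral_eq_integral(2))
  then have "(LINT t:{0..1}|lborel. ?h t) = F w"
    unfolding integral_unique[OF hi] .
  then have "(LINT t|unit_interval. ?h t) = F w"
    unfolding set_lebesgue_integral_def by (subst integral_restrict_space) auto
  also have "\<dots> = exp (\<i> * k * (S - a)) / S"
    unfolding F_def vw using S by simp
  finally show ?thesis .
qed

section \<open>Spherical waves as superpositions of complex plane waves\<close>

lemma integrable_pair_mult:
  fixes f :: "'a \<Rightarrow> real" and g :: "'b \<Rightarrow> real"
  assumes "sigma_finite_measure M" "sigma_finite_measure N" "integrable M f" "integrable N g"
  shows "integrable (M \<Otimes>\<^sub>M N) (\<lambda>p. f (fst p) * g (snd p))"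
proof -
  interpret pair_sigma_finite M N using assms by (simp add: pair_sigma_finite_def)
  have [measurable]: "f \<in> borel_measurable M" "g \<in> borel_measurable N" using assms by auto
  show ?thesis
    by (rule Fubini_integrable) (use assms(3,4) in \<open>auto simp: abs_mult intro!: integrable_mult_left\<close>)
qed

text \<open>The plane waves are indexed by an angle \<open>2\<pi>t\<close>, \<open>t \<in> [0,1]\<close>, and by the Laplace variable \<open>s \<ge> 0\<close>, which
  measures how evanescent the wave is.\<close>

definition wave_param :: "(real \<times> real) measure" where
  "wave_param = unit_interval \<Otimes>\<^sub>M half_line"

lemma sigma_finite_wave_param: "sigma_finite_measure wave_param"
proof -
  interpret pair_sigma_finite unit_interval half_line
    by (simp add: pair_sigma_finite_def sigma_finite_half_line
       finite_measure.axioms finite_unit_interval)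
  show ?thesis unfolding wave_param_def
    using P.sigma_finite_measure_axioms by simp
qed

lemma integrable_exp_wave_param:
  fixes c :: real
  assumes "c > 0"
  shows "integrable wave_param (\<lambda>p. exp (- (c * snd p)))"
  using integrable_pair_mult[OF finite_measure.axioms(1)[OF finite_unit_interval] sigma_finite_half_line
     finite_measure.integrable_const[OF finite_unit_interval, of 1] integrable_exp_half_line[OF assms]]
  by (simp add: wave_param_def)

lemma space_wave_param: "space wave_param = {0..1} \<times> {0..}"
  by (simp add: wave_param_def space_pair_measure space_restrict_space)

lemma measurable_wave_param [measurable]:
  "fst \<in> borel_measurable wave_param" "snd \<in> borel_measurable wave_param"
  unfolding wave_param_def
  by (rule measurable_compose[OF measurable_fst], rule measurable_restrict_space1, simp,
      rule measurable_compose[OF measurable_snd], rule measurable_restrict_space1, simp)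

text \<open>An orthonormal basis; Pythagoras' identity stands for completeness.\<close>

locale frame =
  fixes n b c :: "real^3"
  assumes frame: "n \<bullet> n = 1" "b \<bullet> b = 1" "c \<bullet> c = 1" "n \<bullet> b = 0" "n \<bullet> c = 0" "b \<bullet> c = 0"
    and pythagoras: "(norm y)\<^sup>2 = (y \<bullet> n)\<^sup>2 + (y \<bullet> b)\<^sup>2 + (y \<bullet> c)\<^sup>2"

lemma frame_exists:
  fixes n :: "real^3"
  assumes "norm n = 1"
  obtains b c where "frame n b c"
proof -
  obtain b0 :: "real^3" where b0: "b0 \<noteq> 0" "orthogonal n b0"
    by (rule orthogonal_to_vector_exists[of n]) auto
  define b where "b = b0 /\<^sub>R norm b0"
  define c where "c = cross3 n b"
  have nn: "n \<bullet> n = 1" and bb: "b \<bullet> b = 1"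
    using assms b0 by (simp_all add: b_def dot_square_norm power2_eq_square)
  have nb: "n \<bullet> b = 0" using b0 by (simp add: b_def orthogonal_def)
  have cn: "norm b = 1" "norm n = 1" using nn bb by (simp_all add: norm_eq_1)
  have cc: "c \<bullet> c = 1"
    using norm_cross_dot[of n b] cn nb by (simp add: c_def dot_square_norm)
  have "frame n b c"
  proof
    show "(norm y)\<^sup>2 = (y \<bullet> n)\<^sup>2 + (y \<bullet> b)\<^sup>2 + (y \<bullet> c)\<^sup>2" for y
    proof -
      have "cross3 y c = (y \<bullet> b) *\<^sub>R n - (y \<bullet> n) *\<^sub>R b"
        unfolding c_def by (simp add: cross3_simps forall_3)
      then have "(norm (cross3 y c))\<^sup>2 = (y \<bullet> b)\<^sup>2 + (y \<bullet> n)\<^sup>2"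
        using nn bb nb
        by (simp add: power2_norm_eq_inner inner_diff_left inner_diff_right inner_commute[of b n])
          (simp add: power2_eq_square)
      then show ?thesis
        using norm_cross_dot[of y c] cc by (simp add: power_mult_distrib dot_square_norm)
    qed
  qed (use nn bb nb cc in \<open>auto simp: c_def dot_cross_self\<close>)
  then show thesis by (rule that)
qed

context frame
begin

text \<open>Together these two vectors give the complex wave vector \<open>\<zeta> = wave_im - i wave_re\<close>, so that
  \<open>e\<^sup>i\<^sup>\<zeta>\<^sup>\<cdot>\<^sup>y\<close> has exponent \<open>y \<bullet> wave_re + i (y \<bullet> wave_im)\<close>. In coordinates along \<open>n\<close>, \<open>b\<close>, \<open>c\<close>, with
  \<open>u = e\<^sup>2\<^sup>\<pi>\<^sup>i\<^sup>t\<close>, \<open>v = y\<cdot>b + i y\<cdot>c\<close> and \<open>v\<^sup>*\<close> its conjugate, that exponent is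
  \<open>(s - ik)(y\<cdot>n) + s (v u\<^sup>* - v\<^sup>* u)/2 + i k v\<^sup>* u\<close>; it is linear in \<open>y\<close> with
  \<open>\<zeta>\<cdot>\<zeta> = k\<^sup>2\<close>, and it produces the integrand of \<open>circle_average\<close> after integration over \<open>s\<close>.\<close>

definition wave_re :: "real \<Rightarrow> real \<times> real \<Rightarrow> real^3" where
  "wave_re k p = snd p *\<^sub>R n - (k * sin (2*pi*fst p)) *\<^sub>R b + (k * cos (2*pi*fst p)) *\<^sub>R c"

definition wave_im :: "real \<Rightarrow> real \<times> real \<Rightarrow> real^3" where
  "wave_im k p = (- k) *\<^sub>R n + (k * cos (2*pi*fst p) - snd p * sin (2*pi*fst p)) *\<^sub>R b
     + (k * sin (2*pi*fst p) + snd p * cos (2*pi*fst p)) *\<^sub>R c"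

text \<open>The imaginary and real parts of \<open>\<zeta>\<cdot>\<zeta> = k\<^sup>2\<close> are this orthogonality and the next lemma.\<close>

lemma wave_orthogonal: "wave_re k p \<bullet> wave_im k p = 0"
proof -
  define S C where "S = sin (2*pi*fst p)" and "C = cos (2*pi*fst p)"
  have "S\<^sup>2 + C\<^sup>2 = 1" by (simp add: S_def C_def)
  then show ?thesis
    unfolding wave_re_def wave_im_def S_def[symmetric] C_def[symmetric]
    by (simp add: inner_add_left inner_add_right inner_diff_left inner_diff_right frame
        inner_commute[of b n] inner_commute[of c n] inner_commute[of c b]) algebra
qed

lemma wave_dispersion: "wave_im k p \<bullet> wave_im k p = wave_re k p \<bullet> wave_re k p + k\<^sup>2"
proof -
  define S C where "S = sin (2*pi*fst p)" and "C = cos (2*pi*fst p)"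
  have "S\<^sup>2 + C\<^sup>2 = 1" by (simp add: S_def C_def)
  then show ?thesis
    unfolding wave_re_def wave_im_def S_def[symmetric] C_def[symmetric]
    by (simp add: inner_add_left inner_add_right inner_diff_left inner_diff_right frame
        inner_commute[of b n] inner_commute[of c n] inner_commute[of c b]) algebra
qed

lemma wave_re_nonzero:
  assumes "k > 0"
  shows "wave_re k p \<noteq> 0"
proof
  assume 0: "wave_re k p = 0"
  have "wave_re k p \<bullet> b = - (k * sin (2*pi*fst p))" "wave_re k p \<bullet> c = k * cos (2*pi*fst p)"
    by (simp_all add: wave_re_def inner_add_left inner_diff_left frame inner_commute[of c b])
  then have "sin (2*pi*fst p) = 0" "cos (2*pi*fst p) = 0" using 0 assms by simp_all
  then show False using sin_cos_squared_add[of "2*pi*fst p"] by simp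
qed

lemma measurable_wave [measurable]:
  "wave_re k \<in> borel_measurable wave_param" "wave_im k \<in> borel_measurable wave_param"
  unfolding wave_re_def[abs_def] wave_im_def[abs_def] by measurable

text \<open>The factor independent of \<open>y\<close> makes the wave decay like \<open>exp (- s (w - y \<bullet> n))\<close> in \<open>s\<close>,
  where \<open>w\<close> is the distance of the centre \<open>w n\<close> of the spherical wave from the origin.\<close>

definition wave :: "real \<Rightarrow> real \<Rightarrow> real^3 \<Rightarrow> real \<times> real \<Rightarrow> complex" where
  "wave k w y p = exp (of_real (y \<bullet> wave_re k p) + \<i> * of_real (y \<bullet> wave_im k p)
     + (\<i> * of_real k - of_real (snd p)) * of_real w)"

lemma norm_wave_le:
  assumes "k > 0"
  shows "norm (wave k w y p) \<le> exp (2 * k * norm y) * exp (- ((w - y \<bullet> n) * snd p))"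
proof -
  let ?S = "sin (2*pi*fst p)" and ?C = "cos (2*pi*fst p)"
  have n1: "norm b = 1" "norm c = 1" using frame by (simp_all add: norm_eq_1)
  have yb: "\<bar>y \<bullet> b\<bar> \<le> norm y" "\<bar>y \<bullet> c\<bar> \<le> norm y"
    using Cauchy_Schwarz_ineq2[of y b] Cauchy_Schwarz_ineq2[of y c] n1 by simp_all
  have "- (?S * (y \<bullet> b)) + ?C * (y \<bullet> c) \<le> \<bar>?S\<bar> * \<bar>y \<bullet> b\<bar> + \<bar>?C\<bar> * \<bar>y \<bullet> c\<bar>"
    by (simp only: abs_mult[symmetric])
  also have "\<dots> \<le> 1 * norm y + 1 * norm y"
    using yb by (intro add_mono mult_mono) auto
  finally have "k * (- (?S * (y \<bullet> b)) + ?C * (y \<bullet> c)) \<le> k * (2 * norm y)"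
    using assms by (intro mult_left_mono) auto
  then have "y \<bullet> wave_re k p - snd p * w \<le> 2 * k * norm y - (w - y \<bullet> n) * snd p"
    by (simp add: wave_re_def inner_add_right inner_diff_right algebra_simps)
  then show ?thesis
    by (simp add: wave_def norm_exp_eq_Re flip: exp_add)
qed

lemma measurable_wave1 [measurable]: "wave k w y \<in> borel_measurable wave_param"
  unfolding wave_def[abs_def] by measurable

lemma integrable_wave:
  assumes "k > 0" "y \<bullet> n < w"
  shows "integrable wave_param (wave k w y)"
proof (rule Bochner_Integration.integrable_bound)
  show "integrable wave_param (\<lambda>p. exp (2 * k * norm y) * exp (- ((w - y \<bullet> n) * snd p)))"
    using assms by (intro integrable_mult_right integrable_exp_wave_param) auto
qed (use norm_wave_le[OF assms(1)] in auto)

text \<open>Integrating first over the Laplace variable leaves the reciprocal of \<open>z\<close>, whose real part is the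
  distance \<open>a > 0\<close> from \<open>y\<close> to the plane through \<open>w n\<close> orthogonal to \<open>n\<close>; the remaining average over the
  circle is \<open>circle_average\<close>.\<close>

lemma spherical_wave_superposition:
  assumes "k > 0" "y \<bullet> n < w"
  defines "S \<equiv> norm (w *\<^sub>R n - y)"
  shows "(LINT p|wave_param. wave k w y p) = exp (\<i> * k * S) / S"
proof -
  define a where "a = w - y \<bullet> n"
  define v where "v = Complex (y \<bullet> b) (y \<bullet> c)"
  define u where "u = (\<lambda>t. cis (2*pi*t))"
  have a: "a > 0" using assms by (simp add: a_def)
  have S: "S = sqrt (a\<^sup>2 + (norm v)\<^sup>2)"
  proof -
    have "S = sqrt ((norm (w *\<^sub>R n - y))\<^sup>2)" by (simp add: S_def)
    then show ?thesis
      unfolding pythagoras a_def v_def by (simp add: inner_diff_left frame cmod_def add.assoc)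
  qed
  define z where "z = (\<lambda>t. complex_of_real a - (v * cnj (u t) - cnj v * u t) / 2)"
  have Rez: "Re (z t) = a" for t
    by (simp add: z_def)
  have split: "wave k w y (t, s) = exp (\<i> * k * a) * exp (\<i> * k * (cnj v * u t)) * exp (- (z t * of_real s))" for t s
    unfolding wave_def exp_add[symmetric]
    by (rule arg_cong[of _ _ exp])
       (simp add: complex_eq_iff wave_re_def wave_im_def z_def v_def u_def a_def
         inner_add_right inner_diff_right field_simps)
  interpret pair_sigma_finite unit_interval half_line
    by (simp add: pair_sigma_finite_def sigma_finite_half_line
       finite_measure.axioms finite_unit_interval)
  have "(LINT p|wave_param. wave k w y p) = (LINT t|unit_interval. LINT s|half_line. wave k w y (t, s))"
    using integral_fst'[of "wave k w y"] integrable_wave[OF assms(1,2)] by (simp add: wave_param_def)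
  also have "\<dots> = (LINT t|unit_interval. exp (\<i> * k * a) * (exp (\<i> * k * (cnj v * u t)) / z t))"
    unfolding split using laplace_integral_exp Rez a by simp
  also have "\<dots> = exp (\<i> * k * a) * (LINT t|unit_interval. exp (\<i> * k * (cnj v * u t)) / z t)"
    by (rule integral_mult_right_zero)
  also have "\<dots> = exp (\<i> * k * a) * (exp (\<i> * k * (S - a)) / S)"
    unfolding z_def u_def S using circle_average[OF a, of k v] by simp
  also have "\<dots> = exp (\<i> * k * S) / S"
    by (simp add: algebra_simps flip: exp_add)
  finally show ?thesis .
qed

end

section \<open>Fourier transforms on the complex sphere\<close>

text \<open>Difference quotients of \<open>h y\<close> near a point are bounded uniformly in \<open>y\<close>, because Cauchy's inequality
  turns the bound on \<open>h\<close> over a disc into one on its derivative; dominated convergence then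
  differentiates under the integral sign.\<close>

lemma holomorphic_parametric_integral:
  fixes h :: "'a \<Rightarrow> complex \<Rightarrow> complex"
  assumes f: "integrable M f"
    and meas: "\<And>z. (\<lambda>y. h y z) \<in> borel_measurable M"
    and hol: "\<And>y. y \<in> space M \<Longrightarrow> h y holomorphic_on UNIV"
    and bound: "\<And>\<rho>. \<exists>C. \<forall>y\<in>space M. \<forall>z\<in>cball 0 \<rho>. norm (h y z) \<le> C"
  shows "(\<lambda>z. LINT y|M. h y z * f y) holomorphic_on UNIV"
proof -
  have [measurable]: "f \<in> borel_measurable M" using f by auto
  note meas[measurable]
  have "(\<lambda>z. LINT y|M. h y z * f y) field_differentiable at z0" for z0
  proof -
    obtain C where C: "norm (h y z) \<le> C" if "y \<in> space M" "z \<in> cball 0 (norm z0 + 2)" for y z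
      using bound[of "norm z0 + 2"] by blast
    have deriv_bound: "norm (deriv (h y) w) \<le> C" if "y \<in> space M" "w \<in> ball z0 1" for y w
    proof -
      have "z \<in> cball 0 (norm z0 + 2)" if "norm (w - z) = 1" for z
      proof -
        have "norm z \<le> norm z0 + norm (w - z0) + norm (w - z)"
          using norm_triangle_ineq4[of "z0 + (w - z0)" "w - z"] norm_triangle_ineq[of z0 "w - z0"] by simp
        then show ?thesis using that \<open>w \<in> ball z0 1\<close> by (simp add: dist_norm norm_minus_commute)
      qed
      then have "norm ((deriv ^^ 1) (h y) w) \<le> fact 1 * C / 1 ^ 1"
        by (intro Cauchy_inequality)
          (use that hol in \<open>auto intro!: C intro: holomorphic_on_subset holomorphic_on_imp_continuous_on\<close>)
      then show ?thesis by simp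
    qed
    have lip: "norm (h y w - h y z0) \<le> C * norm (w - z0)" if "y \<in> space M" "w \<in> ball z0 1" for y w
    proof (rule field_differentiable_bound[where S = "ball z0 1"])
      show "(h y has_field_derivative deriv (h y) z) (at z within ball z0 1)" for z
        by (rule DERIV_subset[OF holomorphic_derivI[OF hol[OF that(1)]]]) auto
    qed (use that deriv_bound in auto)
    have intg: "integrable M (\<lambda>y. h y z * f y)" if "z \<in> ball z0 1" for z
    proof (rule Bochner_Integration.integrable_bound)
      show "integrable M (\<lambda>y. C * norm (f y))" using f by auto
      have "z \<in> cball 0 (norm z0 + 2)"
        using that norm_triangle_ineq2[of z z0] by (simp add: dist_norm norm_minus_commute)
      then show "AE y in M. norm (h y z * f y) \<le> norm (C * norm (f y))"
        by (auto simp: norm_mult abs_mult intro!: mult_right_mono order_trans[OF C abs_ge_self])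
    qed measurable
    have "((\<lambda>w. ((LINT y|M. h y w * f y) - (LINT y|M. h y z0 * f y)) / (w - z0))
       \<longlongrightarrow> (LINT y|M. deriv (h y) z0 * f y)) (at z0)"
      unfolding tendsto_at_iff_sequentially
    proof (intro allI impI)
      fix X assume X: "\<forall>i. X i \<in> UNIV - {z0}" "X \<longlonglongrightarrow> z0"
      then obtain m where m: "\<And>i. i \<ge> m \<Longrightarrow> X i \<in> ball z0 1"
        by (metis dist_commute lim_sequentially mem_ball zero_less_one)
      define Y where "Y = (\<lambda>i. X (i + m))"
      have Y: "Y i \<noteq> z0" "Y i \<in> ball z0 1" "Y \<longlonglongrightarrow> z0" for i
        using X m LIMSEQ_ignore_initial_segment[OF X(2), of m] by (auto simp: Y_def)
      have z0: "z0 \<in> ball z0 1" by simp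
      have quot: "((LINT y|M. h y (Y i) * f y) - (LINT y|M. h y z0 * f y)) / (Y i - z0)
          = (LINT y|M. (h y (Y i) - h y z0) / (Y i - z0) * f y)" for i
        using intg[OF Y(2)[of i]] intg[OF z0] by (simp add: left_diff_distrib diff_divide_distrib)
      have lim: "(\<lambda>i. (h y (Y i) - h y z0) / (Y i - z0) * f y) \<longlonglongrightarrow> deriv (h y) z0 * f y"
        if "y \<in> space M" for y
      proof (rule tendsto_mult_right)
        have "(h y has_field_derivative deriv (h y) z0) (at z0)"
          using hol[OF that] by (rule holomorphic_derivI) auto
        then show "(\<lambda>i. (h y (Y i) - h y z0) / (Y i - z0)) \<longlonglongrightarrow> deriv (h y) z0"
          unfolding has_field_derivative_iff using Y by (auto simp: tendsto_at_iff_sequentially o_def)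
      qed
      have "(\<lambda>i. LINT y|M. (h y (Y i) - h y z0) / (Y i - z0) * f y) \<longlonglongrightarrow> (LINT y|M. deriv (h y) z0 * f y)"
      proof (rule integral_dominated_convergence[where w = "\<lambda>y. C * norm (f y)"])
        show "(\<lambda>y. deriv (h y) z0 * f y) \<in> borel_measurable M"
          by (rule borel_measurable_LIMSEQ_metric[OF _ lim]) measurable
        have "norm ((h y (Y i) - h y z0) / (Y i - z0)) \<le> C" if "y \<in> space M" for i y
          using lip[OF that Y(2)[of i]] Y(1)[of i] by (simp add: norm_divide divide_le_eq)
        then show "AE y in M. norm ((h y (Y i) - h y z0) / (Y i - z0) * f y) \<le> C * norm (f y)" for i
          by (intro AE_I2) (simp only: norm_mult, intro mult_right_mono norm_ge_zero)
      qed (use f lim in auto)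
      then have "(\<lambda>i. ((LINT y|M. h y (Y i) * f y) - (LINT y|M. h y z0 * f y)) / (Y i - z0))
          \<longlonglongrightarrow> (LINT y|M. deriv (h y) z0 * f y)"
        unfolding quot .
      then show "((\<lambda>w. ((LINT y|M. h y w * f y) - (LINT y|M. h y z0 * f y)) / (w - z0)) \<circ> X)
          \<longlonglongrightarrow> (LINT y|M. deriv (h y) z0 * f y)"
        unfolding Y_def o_def
        using LIMSEQ_offset[where k = m and f = "\<lambda>i. ((LINT y|M. h y (X i) * f y) - (LINT y|M. h y z0 * f y)) / (X i - z0)"]
        by simp
    qed
    then show ?thesis
      unfolding field_differentiable_def has_field_derivative_iff by blast
  qed
  then show ?thesis
    by (simp add: holomorphic_on_def field_differentiable_at_within)
qed

lemma measurable_ident_lebesgue_on [measurable]: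
  "(\<lambda>y. y) \<in> borel_measurable (lebesgue_on (S :: 'a::euclidean_space set))"
  by (intro measurable_restrict_space1 measurable_completion) simp

text \<open>The complex vector \<open>Q - i P\<close> lies on the curve \<open>z \<mapsto> a cos z + b sin z\<close> through the real sphere of radius
  \<open>k\<close>, where \<open>a\<close> and \<open>b\<close> point along \<open>Q\<close> and \<open>P\<close>: it is reached at the imaginary value \<open>z = - i s\<close> with
  \<open>k cosh s = |Q|\<close> and \<open>k sinh s = |P|\<close>. Along the curve the transform is entire and vanishes for
  real \<open>z\<close>, so it vanishes identically.\<close>

lemma complexified_Fourier_zero:
  fixes f :: "real^3 \<Rightarrow> complex"
  assumes f: "integrable (lebesgue_on (ball 0 r)) f" and k: "k > 0"
    and zero: "\<And>\<xi>. norm \<xi> = k \<Longrightarrow> (LINT y|lebesgue_on (ball 0 r). exp (- \<i> * of_real (\<xi> \<bullet> y)) * f y) = 0"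
    and P: "P \<noteq> 0" and PQ: "P \<bullet> Q = 0" "Q \<bullet> Q = P \<bullet> P + k\<^sup>2"
  shows "(LINT y|lebesgue_on (ball 0 r). exp (of_real (y \<bullet> P) + \<i> * of_real (y \<bullet> Q)) * f y) = 0"
proof -
  let ?M = "lebesgue_on (ball (0::real^3) r)"
  define a where "a = (k / norm Q) *\<^sub>R Q"
  define b where "b = (k / norm P) *\<^sub>R P"
  define s where "s = arsinh (norm P / k)"
  define N where "N = (\<lambda>z. LINT y|?M. exp (\<i> * (cos z * of_real (y \<bullet> a) + sin z * of_real (y \<bullet> b))) * f y)"
  have nQ: "norm Q > 0" using PQ k by (metis add_nonneg_pos inner_ge_zero inner_zero_left less_irrefl zero_less_norm_iff zero_less_power)
  have "N holomorphic_on UNIV"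
    unfolding N_def
  proof (rule holomorphic_parametric_integral[OF f])
    fix \<rho> :: real
    have C: "norm (cos z) \<le> C1" "norm (sin z) \<le> C1" if "z \<in> cball 0 \<rho>" and "C1 = exp (pi / 2 + \<rho>)" for z :: complex and C1
    proof -
      have "norm (of_real pi / 2 - z) \<le> pi / 2 + \<rho>"
        using that norm_triangle_ineq4[of "of_real pi / 2" z] by simp
      moreover have "norm z \<le> pi / 2 + \<rho>"
        using that(1) pi_gt_zero unfolding mem_cball_0 by linarith
      ultimately have "exp (norm z) \<le> C1" "exp (norm (of_real pi / 2 - z)) \<le> C1"
        using that by simp_all
      then show "norm (cos z) \<le> C1" "norm (sin z) \<le> C1"
        using order_trans[OF norm_cos_le[of z]] order_trans[OF norm_cos_le[of "of_real pi / 2 - z"]]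
        by (simp_all add: sin_cos_eq)
    qed
    define C1 where "C1 = exp (pi / 2 + \<rho>)"
    note C = C[OF _ C1_def]
    have "norm (exp (\<i> * (cos z * of_real (y \<bullet> a) + sin z * of_real (y \<bullet> b)))) \<le> exp (C1 * (r * norm a) + C1 * (r * norm b))"
      if y: "y \<in> space ?M" and z: "z \<in> cball 0 \<rho>" for y z
    proof -
      have yr: "norm y \<le> r" using y by simp
      have ya: "\<bar>y \<bullet> e\<bar> \<le> r * norm e" for e
        using Cauchy_Schwarz_ineq2[of y e] mult_right_mono[OF yr norm_ge_zero[of e]] by linarith
      have "norm (\<i> * (cos z * of_real (y \<bullet> a) + sin z * of_real (y \<bullet> b)))
          \<le> norm (cos z) * \<bar>y \<bullet> a\<bar> + norm (sin z) * \<bar>y \<bullet> b\<bar>"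
        using norm_triangle_ineq[of "cos z * of_real (y \<bullet> a)" "sin z * of_real (y \<bullet> b)"]
        by (simp add: norm_mult)
      also have "\<dots> \<le> C1 * (r * norm a) + C1 * (r * norm b)"
        using C[OF z] ya order_trans[OF norm_ge_zero C(1)[OF z]] order_trans[OF norm_ge_zero C(2)[OF z]]
        by (intro add_mono mult_mono) auto
      finally show ?thesis
        by (intro order_trans[OF norm_exp]) simp
    qed
    then show "\<exists>C. \<forall>y\<in>space ?M. \<forall>z\<in>cball 0 \<rho>.
        norm (exp (\<i> * (cos z * of_real (y \<bullet> a) + sin z * of_real (y \<bullet> b)))) \<le> C" by blast
  qed (auto intro!: holomorphic_intros)
  moreover have "N z = 0" if "z \<in> \<real>" for z
  proof -
    from that obtain x where x: "z = of_real x" by (elim Reals_cases)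
    define \<xi> where "\<xi> = - (cos x *\<^sub>R a + sin x *\<^sub>R b)"
    have ab: "a \<bullet> a = k\<^sup>2" "b \<bullet> b = k\<^sup>2" "a \<bullet> b = 0"
      using nQ P PQ(1) by (auto simp: a_def b_def dot_square_norm power2_eq_square inner_commute)
    have "b \<bullet> a = 0" using ab(3) by (simp add: inner_commute)
    with ab have "\<xi> \<bullet> \<xi> = (cos x * cos x + sin x * sin x) * k\<^sup>2"
      unfolding \<xi>_def inner_minus_left inner_minus_right minus_minus
      by (simp only: inner_add_left inner_add_right inner_scaleR_left inner_scaleR_right)
        (simp only: algebra_simps mult_zero_right add_0_left add_0_right)
    then have "\<xi> \<bullet> \<xi> = k\<^sup>2"
      using sin_cos_squared_add2[of x] by (simp add: power2_eq_square)
    then have "norm \<xi> = k" using k by (simp add: norm_eq_sqrt_inner)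
    have eq: "- \<i> * of_real (\<xi> \<bullet> y) = \<i> * (cos z * of_real (y \<bullet> a) + sin z * of_real (y \<bullet> b))" for y
      unfolding \<xi>_def x cos_of_real sin_of_real inner_minus_left inner_add_left inner_scaleR_left
        inner_commute[of a y] inner_commute[of b y] by (simp add: algebra_simps)
    show ?thesis
      using zero[OF \<open>norm \<xi> = k\<close>] unfolding N_def eq .
  qed
  moreover have "(0::complex) islimpt \<real>"
    unfolding islimpt_approachable
  proof (intro allI impI)
    fix e :: real assume "e > 0"
    then show "\<exists>x\<in>\<real>. x \<noteq> (0::complex) \<and> dist x 0 < e"
      by (intro bexI[of _ "of_real (e / 2)"]) auto
  qed
  ultimately have N0: "N (- \<i> * of_real s) = 0"
    using analytic_continuation[of N UNIV "\<real>" 0 "- \<i> * of_real s"] by auto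
  have cs: "cos (- \<i> * of_real s) = complex_of_real (norm Q / k)"
      "sin (- \<i> * of_real s) = - \<i> * complex_of_real (norm P / k)"
  proof -
    have "(norm Q)\<^sup>2 = (norm P)\<^sup>2 + k\<^sup>2" using PQ(2) by (simp add: dot_square_norm)
    then have "(norm P / k)\<^sup>2 + 1 = (norm Q / k)\<^sup>2" using k by (simp add: field_simps)
    moreover have sinh: "sinh s = norm P / k" by (simp add: s_def)
    ultimately have "(cosh s)\<^sup>2 = (norm Q / k)\<^sup>2" by (simp add: cosh_square_eq)
    then have "cosh s = norm Q / k"
      by (rule power2_eq_imp_eq) (use nQ k in auto)
    moreover have "cosh (complex_of_real s) = of_real (cosh s)" "sinh (complex_of_real s) = of_real (sinh s)"
      by (simp_all add: cosh_field_def sinh_field_def exp_of_real flip: of_real_minus)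
    ultimately show "cos (- \<i> * of_real s) = complex_of_real (norm Q / k)"
      "sin (- \<i> * of_real s) = - \<i> * complex_of_real (norm P / k)"
      using sinh by (simp_all add: cosh_conv_cos sinh_conv_sin complex_eq_iff)
  qed
  have "\<i> * (complex_of_real (norm Q / k) * of_real (y \<bullet> a) + - \<i> * complex_of_real (norm P / k) * of_real (y \<bullet> b))
      = of_real (y \<bullet> P) + \<i> * of_real (y \<bullet> Q)" for y
    using nQ P k by (simp add: a_def b_def algebra_simps)
  then show ?thesis
    using N0 unfolding N_def cs by simp
qed

section \<open>Outgoing Helmholtz fields and the Fourier transform on the sphere\<close>

text \<open>The frame is adapted to \<open>x\<close>: with \<open>n = x / |x|\<close> and \<open>w = |x| > r\<close> the expansion of \<open>g(x,y)\<close> is valid for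
  every \<open>y\<close> in the ball, with the uniform decay rate \<open>w - r\<close> in the Laplace variable. That rate is what
  makes Fubini's theorem applicable.\<close>

lemma outgoing_field_zero_if_Fourier_zero:
  fixes f :: "real^3 \<Rightarrow> complex"
  assumes f: "integrable (lebesgue_on (ball 0 r)) f" and k: "k > 0" and r: "r > 0"
    and zero: "\<And>\<xi>. norm \<xi> = k \<Longrightarrow> (LINT y|lebesgue_on (ball 0 r). exp (- \<i> * of_real (\<xi> \<bullet> y)) * f y) = 0"
    and x: "norm x > r"
  shows "(LINT y|lebesgue_on (ball 0 r). green k x y * f y) = 0"
proof -
  let ?M = "lebesgue_on (ball (0::real^3) r)"
  have [measurable]: "f \<in> borel_measurable ?M" using f by auto
  define w where "w = norm x"
  define n where "n = x /\<^sub>R w"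
  have w: "w > r" "w > 0" using x r by (auto simp: w_def)
  have "norm n = 1" using w by (simp add: n_def w_def)
  then obtain b c where "frame n b c" by (rule frame_exists)
  then interpret frame n b c .
  have xn: "x = w *\<^sub>R n" using w by (simp add: n_def)
  have yn: "y \<bullet> n \<le> norm y" for y
    using norm_cauchy_schwarz[of y n] \<open>norm n = 1\<close> by simp
  have green: "green k x y = of_real (1 / (4 * pi)) * (LINT p|wave_param. wave k w y p)"
    if "y \<in> space ?M" for y
  proof -
    have "y \<bullet> n < w" using yn[of y] that w by simp
    from spherical_wave_superposition[OF k this] show ?thesis
      by (simp add: green_def xn mult.assoc)
  qed
  have sf: "sigma_finite_measure ?M"
    by (intro finite_measure.axioms(1) finite_measure_lebesgue_on) simp
  interpret pair_sigma_finite ?M wave_param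
    by (simp add: pair_sigma_finite_def sf sigma_finite_wave_param)
  have [measurable]: "(\<lambda>q. fst q) \<in> borel_measurable (?M \<Otimes>\<^sub>M wave_param)"
    by (rule measurable_compose[OF measurable_fst measurable_ident_lebesgue_on])
  have bound: "norm (wave k w y p * f y) \<le> norm (f y) * (exp (2 * k * r) * exp (- ((w - r) * snd p)))"
    if y: "y \<in> space ?M" and p: "p \<in> space wave_param" for y p
  proof -
    have yr: "norm y \<le> r" using y by simp
    have "(w - r) * snd p \<le> (w - y \<bullet> n) * snd p"
      using p yn[of y] yr by (intro mult_right_mono) (auto simp: space_wave_param)
    moreover have "2 * k * norm y \<le> 2 * k * r" using yr k by simp
    ultimately have "exp (2 * k * norm y) * exp (- ((w - y \<bullet> n) * snd p)) \<le> exp (2 * k * r) * exp (- ((w - r) * snd p))"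
      by (intro mult_mono) auto
    then have "norm (wave k w y p) \<le> exp (2 * k * r) * exp (- ((w - r) * snd p))"
      using norm_wave_le[OF k, of w y p] by linarith
    then show ?thesis
      unfolding norm_mult by (subst mult.commute) (intro mult_left_mono norm_ge_zero)
  qed
  have int: "integrable (?M \<Otimes>\<^sub>M wave_param) (\<lambda>(y, p). wave k w y p * f y)"
  proof (rule Bochner_Integration.integrable_bound)
    show "integrable (?M \<Otimes>\<^sub>M wave_param) (\<lambda>q. norm (f (fst q)) * (exp (2 * k * r) * exp (- ((w - r) * snd (snd q)))))"
      using f w integrable_pair_mult[OF sf sigma_finite_wave_param, of "\<lambda>y. norm (f y)"
          "\<lambda>p. exp (2 * k * r) * exp (- ((w - r) * snd p))"] integrable_exp_wave_param[of "w - r"]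
      by simp
    show "(\<lambda>(y, p). wave k w y p * f y) \<in> borel_measurable (?M \<Otimes>\<^sub>M wave_param)"
      unfolding wave_def split_beta by measurable
    show "AE q in ?M \<Otimes>\<^sub>M wave_param. norm (case q of (y, p) \<Rightarrow> wave k w y p * f y) \<le>
        norm (norm (f (fst q)) * (exp (2 * k * r) * exp (- ((w - r) * snd (snd q)))))"
      by (rule AE_I2) (use bound in \<open>auto simp: space_pair_measure abs_mult simp del: norm_mult\<close>)
  qed
  have "(LINT y|?M. green k x y * f y)
      = (LINT y|?M. of_real (1 / (4 * pi)) * (LINT p|wave_param. wave k w y p * f y))"
    by (rule Bochner_Integration.integral_cong) (simp_all add: green del: space_lebesgue_on space_restrict_space)
  also have "\<dots> = of_real (1 / (4 * pi)) * (LINT p|wave_param. LINT y|?M. wave k w y p * f y)"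
    using Fubini_integral[OF int] by simp
  also have "\<dots> = 0"
  proof -
    have "(LINT y|?M. wave k w y p * f y) = 0" for p
    proof -
    have "(LINT y|?M. wave k w y p * f y) = (LINT y|?M. exp ((\<i> * of_real k - of_real (snd p)) * of_real w) *
        (exp (of_real (y \<bullet> wave_re k p) + \<i> * of_real (y \<bullet> wave_im k p)) * f y))"
      by (simp add: wave_def exp_add mult_ac)
    then show ?thesis
      using complexified_Fourier_zero[OF f k zero wave_re_nonzero[OF k] wave_orthogonal wave_dispersion] by simp
    qed
    then show ?thesis by simp
  qed
  finally show ?thesis .
qed

text \<open>As \<open>t \<rightarrow> \<infinity>\<close>, \<open>|t n - y| - t \<rightarrow> - n\<cdot>y\<close>, so \<open>4\<pi>t e\<^sup>-\<^sup>i\<^sup>k\<^sup>t g(t n, y)\<close> converges to the plane wave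
  \<open>e\<^sup>-\<^sup>i\<^sup>k\<^sup>n\<^sup>\<cdot>\<^sup>y\<close>, boundedly for \<open>y\<close> in the ball.\<close>

lemma Fourier_zero_if_outgoing_field_zero:
  fixes f :: "real^3 \<Rightarrow> complex"
  assumes f: "integrable (lebesgue_on (ball 0 r)) f" and k: "k > 0" and r: "r > 0"
    and zero: "\<And>x. norm x > \<rho> \<Longrightarrow> (LINT y|lebesgue_on (ball 0 r). green k x y * f y) = 0"
    and \<xi>: "norm \<xi> = k"
  shows "(LINT y|lebesgue_on (ball 0 r). exp (- \<i> * of_real (\<xi> \<bullet> y)) * f y) = 0"
proof -
  let ?M = "lebesgue_on (ball (0::real^3) r)"
  have [measurable]: "f \<in> borel_measurable ?M" using f by auto
  define n where "n = \<xi> /\<^sub>R k"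
  have n: "norm n = 1" "\<xi> = k *\<^sub>R n" using k \<xi> by (auto simp: n_def)
  \<comment> \<open>Beyond \<open>2 r\<close> the quotient \<open>t / |t n - y|\<close> is at most \<open>2\<close>.\<close>
  obtain N :: nat where N: "real N > max \<rho> (2 * r)" using reals_Archimedean2 by blast
  define d where "d = (\<lambda>m y. norm (real (m + N) *\<^sub>R n - y))"
  define g where "g = (\<lambda>m y. exp (\<i> * of_real (k * (d m y - real (m + N)))) * of_real (real (m + N) / d m y))"
  have d: "d m y = sqrt ((real (m + N))\<^sup>2 - 2 * (n \<bullet> y) * real (m + N) + (norm y)\<^sup>2)" for m y
    unfolding d_def norm_eq_sqrt_inner
    using n(1) by (simp add: inner_diff_left inner_diff_right inner_commute[of y n] norm_eq_1 power2_eq_square algebra_simps)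
  have "(LINT y|?M. g m y * f y) = 0" for m
  proof -
    have *: "g m y = (of_real (4 * pi * real (m + N)) * exp (- \<i> * of_real (k * real (m + N)))) * green k (real (m + N) *\<^sub>R n) y" for y
    proof -
      define M where "M = real (m + N)"
      have e: "exp (\<i> * of_real (k * (d m y - M))) = exp (- \<i> * of_real (k * M)) * exp (\<i> * of_real (k * d m y))"
        by (simp add: algebra_simps flip: exp_add)
      have "norm (M *\<^sub>R n - y) = d m y" by (simp add: d_def M_def)
      then show ?thesis
        unfolding g_def green_def M_def[symmetric] e by simp
    qed
    have "norm (real (m + N) *\<^sub>R n) > \<rho>" using N n by simp
    from zero[OF this] show ?thesis unfolding * mult.assoc by simp
  qed
  moreover have "(\<lambda>m. LINT y|?M. g m y * f y) \<longlonglongrightarrow> (LINT y|?M. exp (- \<i> * of_real (\<xi> \<bullet> y)) * f y)"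
  proof (rule integral_dominated_convergence[where w = "\<lambda>y. 2 * norm (f y)"])
    show "(\<lambda>y. exp (- \<i> * of_real (\<xi> \<bullet> y)) * f y) \<in> borel_measurable ?M" by measurable
    show "(\<lambda>y. g m y * f y) \<in> borel_measurable ?M" for m unfolding g_def d_def by measurable
    show "integrable ?M (\<lambda>y. 2 * norm (f y))" using f by auto
    show "AE y in ?M. (\<lambda>m. g m y * f y) \<longlonglongrightarrow> exp (- \<i> * of_real (\<xi> \<bullet> y)) * f y"
    proof (intro AE_I2 tendsto_mult_right)
      fix y
      have "((\<lambda>t. sqrt (t\<^sup>2 - 2 * (n \<bullet> y) * t + (norm y)\<^sup>2) - t) \<longlongrightarrow> - (n \<bullet> y)) at_top"
        by real_asymp
      then have 1: "(\<lambda>m. d m y - real (m + N)) \<longlonglongrightarrow> - (n \<bullet> y)"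
        unfolding d by (rule filterlim_compose) real_asymp
      have "((\<lambda>t. t / sqrt (t\<^sup>2 - 2 * (n \<bullet> y) * t + (norm y)\<^sup>2)) \<longlongrightarrow> 1) at_top"
        by real_asymp
      then have 2: "(\<lambda>m. real (m + N) / d m y) \<longlonglongrightarrow> 1"
        unfolding d by (rule filterlim_compose) real_asymp
      have "(\<lambda>m. g m y) \<longlonglongrightarrow> exp (\<i> * of_real (k * - (n \<bullet> y))) * of_real 1"
        unfolding g_def by (intro tendsto_intros 1 2)
      then show "(\<lambda>m. g m y) \<longlonglongrightarrow> exp (- \<i> * of_real (\<xi> \<bullet> y))"
        by (simp add: n(2))
    qed
    have "norm (g m y) \<le> 2" if "y \<in> space ?M" for m y
    proof -
      have "d m y \<ge> real (m + N) - norm y"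
        unfolding d_def using norm_triangle_ineq2[of "real (m + N) *\<^sub>R n" y] n by simp
      moreover have "norm y < r" using that by simp
      ultimately have "d m y \<ge> real (m + N) / 2" "d m y > 0" using N r by auto
      then show ?thesis
        unfolding g_def norm_mult norm_exp_i_times norm_of_real by (simp add: divide_le_eq)
    qed
    then show "AE y in ?M. norm (g m y * f y) \<le> 2 * norm (f y)" for m
      by (intro AE_I2) (simp only: norm_mult, intro mult_right_mono norm_ge_zero)
  qed
  ultimately show ?thesis using LIMSEQ_unique[OF _ tendsto_const] by simp
qed

section \<open>A calculus of iterated partial derivatives\<close>

lemma has_partial_deriv:
  assumes "f differentiable (at x)"
  shows "((\<lambda>t. f (x + t *\<^sub>R axis i 1)) has_vector_derivative partial_deriv i f x) (at 0)"
proof -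
  have "(f \<circ> (\<lambda>t. x + t *\<^sub>R axis i 1)) differentiable (at (0::real))"
    by (rule differentiable_chain_at) (use assms in \<open>auto intro!: derivative_intros\<close>)
  then show ?thesis
    unfolding partial_deriv_def o_def by (simp add: vector_derivative_works)
qed

lemma partial_deriv_eqI:
  assumes "((\<lambda>t. f (x + t *\<^sub>R axis i 1)) has_vector_derivative D) (at 0)"
  shows "partial_deriv i f x = D"
  unfolding partial_deriv_def using assms by (rule vector_derivative_at)

lemma partial_deriv_cong:
  assumes "open S" "x \<in> S" "\<And>y. y \<in> S \<Longrightarrow> f y = g y"
  shows "partial_deriv i f x = partial_deriv i g x"
proof -
  have "((\<lambda>t. x + t *\<^sub>R axis i 1) \<longlongrightarrow> x + 0 *\<^sub>R axis i 1) (nhds (0::real))"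
    by (intro tendsto_intros filterlim_ident)
  then have "eventually (\<lambda>t::real. x + t *\<^sub>R axis i 1 \<in> S) (nhds 0)"
    using assms(1,2) by (intro topological_tendstoD) auto
  then have "eventually (\<lambda>t. f (x + t *\<^sub>R axis i 1) = g (x + t *\<^sub>R axis i 1)) (nhds 0)"
    by (rule eventually_mono) (use assms(3) in auto)
  then show ?thesis
    unfolding partial_deriv_def by (intro vector_derivative_cong_eq) auto
qed

lemma partial_deriv_add:
  assumes "f differentiable (at x)" "g differentiable (at x)"
  shows "partial_deriv i (\<lambda>x. f x + g x) x = partial_deriv i f x + partial_deriv i g x"
  by (rule partial_deriv_eqI) (intro has_vector_derivative_add has_partial_deriv assms)

lemma partial_deriv_mult:
  assumes "f differentiable (at x)" "g differentiable (at x)"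
  shows "partial_deriv i (\<lambda>x. f x * g x) x = f x * partial_deriv i g x + partial_deriv i f x * g x"
  using has_vector_derivative_mult[OF assms[THEN has_partial_deriv]]
  by (intro partial_deriv_eqI) simp

lemma partial_deriv_const [simp]: "partial_deriv i (\<lambda>x. c) = (\<lambda>x. 0)"
  by (rule ext, rule partial_deriv_eqI) (rule has_vector_derivative_const)

lemma partial_deriv_field_compose:
  assumes f: "f differentiable (at x)" and h: "(h has_field_derivative h') (at (f x))"
  shows "partial_deriv i (\<lambda>x. h (f x)) x = partial_deriv i f x * h'"
  using field_vector_diff_chain_at[OF has_partial_deriv[OF f, of i], of h h'] h
  by (intro partial_deriv_eqI) (simp add: o_def)

text \<open>All iterated partial derivatives of order at most \<open>n\<close> are Frechet differentiable at the points of \<open>S\<close>.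
  Recursion on \<open>n\<close>, peeling off the innermost derivative, makes closure under the algebraic operations
  provable by induction; smoothness is the conjunction over all \<open>n\<close>.\<close>

primrec diff_upto :: "(real^3) set \<Rightarrow> nat \<Rightarrow> (real^3 \<Rightarrow> complex) \<Rightarrow> bool" where
  "diff_upto S 0 f \<longleftrightarrow> (\<forall>x\<in>S. f differentiable (at x))"
| "diff_upto S (Suc n) f \<longleftrightarrow> (\<forall>x\<in>S. f differentiable (at x)) \<and> (\<forall>i. diff_upto S n (partial_deriv i f))"

lemma diff_upto_differentiable: "diff_upto S n f \<Longrightarrow> x \<in> S \<Longrightarrow> f differentiable (at x)"
  by (cases n) auto

lemma diff_upto_Suc_imp: "diff_upto S (Suc n) f \<Longrightarrow> diff_upto S n f"
  by (induction n arbitrary: f) auto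

lemma diff_upto_partial: "diff_upto S (Suc n) f \<Longrightarrow> diff_upto S n (partial_deriv i f)"
  by simp

lemma diff_upto_subset: "diff_upto S n f \<Longrightarrow> T \<subseteq> S \<Longrightarrow> diff_upto T n f"
  by (induction n arbitrary: f) auto

lemma diff_upto_Un: "diff_upto S n f \<Longrightarrow> diff_upto T n f \<Longrightarrow> diff_upto (S \<union> T) n f"
  by (induction n arbitrary: f) auto

lemma differentiable_cong_open:
  assumes "open S" "x \<in> S" "\<And>y. y \<in> S \<Longrightarrow> f y = g y" "f differentiable (at x)"
  shows "g differentiable (at x)"
  using assms has_derivative_transform_within_open[of f _ x UNIV S g] by (auto simp: differentiable_def)

lemma diff_upto_cong:
  assumes "open S" "\<And>y. y \<in> S \<Longrightarrow> f y = g y" "diff_upto S n f"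
  shows "diff_upto S n g"
  using assms(2,3)
proof (induction n arbitrary: f g)
  case 0
  then show ?case
    using differentiable_cong_open[OF assms(1)] by (metis diff_upto.simps(1))
next
  case (Suc n)
  have "diff_upto S n (partial_deriv i g)" for i
  proof (rule Suc.IH)
    show "partial_deriv i f y = partial_deriv i g y" if "y \<in> S" for y
      using assms(1) that Suc.prems(1) by (rule partial_deriv_cong)
    show "diff_upto S n (partial_deriv i f)" using Suc.prems(2) by simp
  qed
  moreover have "g differentiable (at x)" if "x \<in> S" for x
    using Suc.prems(1) diff_upto_differentiable[OF Suc.prems(2) that]
    by (rule differentiable_cong_open[OF assms(1) that])
  ultimately show ?case by simp
qed

lemma diff_upto_const [simp, intro]: "diff_upto S n (\<lambda>x. c)"
  by (induction n arbitrary: c) auto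

lemma diff_upto_SucI:
  assumes "open S" "\<And>x. x \<in> S \<Longrightarrow> f differentiable (at x)"
    and "\<And>i x. x \<in> S \<Longrightarrow> partial_deriv i f x = g i x" and "\<And>i. diff_upto S n (g i)"
  shows "diff_upto S (Suc n) f"
proof -
  have "diff_upto S n (partial_deriv i f)" for i
    by (rule diff_upto_cong[OF assms(1) _ assms(4)[of i]]) (simp add: assms(3))
  then show ?thesis using assms(2) by simp
qed

lemma diff_upto_add:
  assumes "open S"
  shows "diff_upto S n f \<Longrightarrow> diff_upto S n g \<Longrightarrow> diff_upto S n (\<lambda>x. f x + g x)"
proof (induction n arbitrary: f g)
  case (Suc n)
  note d = Suc.prems[THEN diff_upto_differentiable]
  show ?case
  proof (rule diff_upto_SucI[OF assms _ partial_deriv_add[OF d]])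
    show "diff_upto S n (\<lambda>x. partial_deriv i f x + partial_deriv i g x)" for i
      by (intro Suc.IH diff_upto_partial Suc.prems)
  qed (use d in \<open>auto intro!: differentiable_add\<close>)
qed (auto intro!: differentiable_add)

lemma diff_upto_mult:
  assumes "open S"
  shows "diff_upto S n f \<Longrightarrow> diff_upto S n g \<Longrightarrow> diff_upto S n (\<lambda>x. f x * g x)"
proof (induction n arbitrary: f g)
  case (Suc n)
  note d = Suc.prems[THEN diff_upto_differentiable]
  show ?case
  proof (rule diff_upto_SucI[OF assms _ partial_deriv_mult[OF d]])
    show "diff_upto S n (\<lambda>x. f x * partial_deriv i g x + partial_deriv i f x * g x)" for i
      by (intro diff_upto_add[OF assms] Suc.IH diff_upto_partial diff_upto_Suc_imp[OF Suc.prems(1)] diff_upto_Suc_imp[OF Suc.prems(2)] Suc.prems)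
  qed (use d in \<open>auto intro!: differentiable_mult\<close>)
qed (auto intro!: differentiable_mult)

lemma differentiable_field_compose:
  fixes f :: "real^3 \<Rightarrow> complex"
  assumes "f differentiable (at x)" and "(h has_field_derivative h') (at (f x))"
  shows "(\<lambda>x. h (f x)) differentiable (at x)"
  using differentiable_chain_at[OF assms(1), of h] assms(2)
  by (auto simp: o_def differentiable_def has_field_derivative_def)

text \<open>One induction serves for \<open>inverse\<close> and \<open>exp\<close>: the chain rule expresses the partial derivatives of
  \<open>h \<circ> f\<close> through \<open>h' \<circ> f\<close>, which is again as differentiable as \<open>f\<close> and \<open>h \<circ> f\<close> are.\<close>

lemma diff_upto_compose_field:
  assumes "open S"
    and h: "\<And>x. x \<in> S \<Longrightarrow> (h has_field_derivative h' (f x)) (at (f x))"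
    and h': "\<And>n. diff_upto S n f \<Longrightarrow> diff_upto S n (\<lambda>x. h (f x)) \<Longrightarrow> diff_upto S n (\<lambda>x. h' (f x))"
  shows "diff_upto S n f \<Longrightarrow> diff_upto S n (\<lambda>x. h (f x))"
proof (induction n)
  case 0
  then show ?case using differentiable_field_compose[OF _ h] by simp
next
  case (Suc n)
  note d = diff_upto_differentiable[OF Suc.prems]
  note f = diff_upto_Suc_imp[OF Suc.prems]
  show ?case
  proof (rule diff_upto_SucI[OF assms(1)])
    show "diff_upto S n (\<lambda>x. partial_deriv i f x * h' (f x))" for i
      by (intro diff_upto_mult[OF assms(1)] diff_upto_partial[OF Suc.prems] h' f Suc.IH)
    show "partial_deriv i (\<lambda>x. h (f x)) x = partial_deriv i f x * h' (f x)" if "x \<in> S" for i x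
      by (rule partial_deriv_field_compose[OF d[OF that] h[OF that]])
    show "(\<lambda>x. h (f x)) differentiable (at x)" if "x \<in> S" for x
      by (rule differentiable_field_compose[OF d[OF that] h[OF that]])
  qed
qed

lemma diff_upto_inverse:
  assumes "open S" and "\<And>x. x \<in> S \<Longrightarrow> f x \<noteq> 0" and "diff_upto S n f"
  shows "diff_upto S n (\<lambda>x. inverse (f x))"
proof (rule diff_upto_compose_field[OF assms(1) DERIV_inverse])
  fix n assume "diff_upto S n (\<lambda>x. inverse (f x))"
  from diff_upto_mult[OF assms(1) diff_upto_const[of S n "-1"] diff_upto_mult[OF assms(1) this this]]
  show "diff_upto S n (\<lambda>x. - (inverse (f x) ^ Suc (Suc 0)))" by simp
qed (use assms in auto)

lemma diff_upto_exp:
  assumes "open S" "diff_upto S n f"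
  shows "diff_upto S n (\<lambda>x. exp (f x))"
  by (rule diff_upto_compose_field[OF assms(1) DERIV_exp _ assms(2)])

lemma of_real_differentiable:
  fixes q :: "real^3 \<Rightarrow> real"
  assumes "(q has_derivative D) (at x)"
  shows "(\<lambda>x. complex_of_real (q x)) differentiable (at x)"
    and "partial_deriv i (\<lambda>x. complex_of_real (q x)) x = of_real (D (axis i 1))"
proof -
  have *: "((\<lambda>x. complex_of_real (q x)) has_derivative (\<lambda>h. of_real (D h))) (at x)"
    by (rule has_derivative_of_real[OF assms])
  then show d: "(\<lambda>x. complex_of_real (q x)) differentiable (at x)"
    by (auto simp: differentiable_def)
  have "((\<lambda>t::real. x + t *\<^sub>R axis i 1) has_vector_derivative axis i 1) (at 0)"
    by (auto intro!: derivative_eq_intros simp: has_vector_derivative_def)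
  from vector_derivative_diff_chain_within[OF this, of "\<lambda>x. complex_of_real (q x)" "\<lambda>h. of_real (D h)"] *
  show "partial_deriv i (\<lambda>x. complex_of_real (q x)) x = of_real (D (axis i 1))"
    by (intro partial_deriv_eqI) (simp add: o_def has_derivative_at_withinI)
qed

lemma diff_upto_inner: "diff_upto S n (\<lambda>x. of_real (a \<bullet> (x - c)))"
proof -
  have d: "((\<lambda>x. a \<bullet> (x - c)) has_derivative (\<lambda>h. a \<bullet> h)) (at x)" for x
    by (auto intro!: derivative_eq_intros)
  have "partial_deriv i (\<lambda>x. complex_of_real (a \<bullet> (x - c))) = (\<lambda>x. of_real (a \<bullet> axis i 1))" for i
    by (rule ext) (rule of_real_differentiable(2)[OF d])
  then show ?thesis
    by (cases n) (auto intro!: of_real_differentiable(1)[OF d] diff_upto_const)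
qed

lemma partial_deriv_norm:
  assumes "x \<noteq> c"
  shows "(\<lambda>x. complex_of_real (norm (x - c))) differentiable (at x)"
    and "partial_deriv i (\<lambda>x. complex_of_real (norm (x - c))) x
       = of_real ((x - c) $ i) * inverse (of_real (norm (x - c)))"
proof -
  have d: "((\<lambda>x. norm (x - c)) has_derivative (\<lambda>h. h \<bullet> sgn (x - c))) (at x)"
  proof -
    have "((\<lambda>x. x - c) has_derivative (\<lambda>h. h)) (at x)" by (auto intro!: derivative_eq_intros)
    then show ?thesis
      using has_derivative_compose[OF _ has_derivative_norm, of "\<lambda>x. x - c" "\<lambda>h. h" x UNIV] assms by simp
  qed
  show "(\<lambda>x. complex_of_real (norm (x - c))) differentiable (at x)"
    by (rule of_real_differentiable(1)[OF d])
  show "partial_deriv i (\<lambda>x. complex_of_real (norm (x - c))) x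
       = of_real ((x - c) $ i) * inverse (of_real (norm (x - c)))"
    unfolding of_real_differentiable(2)[OF d]
    by (simp add: sgn_div_norm inner_axis' mult.commute)
qed

lemma diff_upto_norm: "diff_upto (- {c}) n (\<lambda>x. of_real (norm (x - c)))"
proof (induction n)
  case 0
  then show ?case using partial_deriv_norm by auto
next
  case (Suc n)
  have "diff_upto (- {c}) n (\<lambda>x. of_real (axis i 1 \<bullet> (x - c)) * inverse (of_real (norm (x - c))))" for i
    by (intro diff_upto_mult diff_upto_inner diff_upto_inverse Suc) auto
  then have "diff_upto (- {c}) n (\<lambda>x. of_real ((x - c) $ i) * inverse (of_real (norm (x - c))))" for i
    by (simp add: inner_axis')
  then show ?case
    by (rule diff_upto_SucI[rotated 3]) (use partial_deriv_norm in auto)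
qed

lemma diff_upto_imp_iterated_differentiable:
  "diff_upto S (length is) f \<Longrightarrow> x \<in> S \<Longrightarrow> foldr partial_deriv is f differentiable (at x)"
  by (induction "is" arbitrary: f rule: rev_induct) auto

lemma smoothI: "(\<And>n. diff_upto UNIV n f) \<Longrightarrow> smooth f"
  unfolding smooth_def differentiable_on_def
  using diff_upto_imp_iterated_differentiable[of UNIV] by (auto simp: differentiable_at_withinI)

section \<open>Derivatives of the scalar Green function\<close>

lemma partial_deriv_radial:
  assumes F: "F holomorphic_on - {0}" and x: "x \<noteq> c"
  shows "partial_deriv i (\<lambda>x. F (of_real (norm (x - c)))) x
    = of_real ((x - c) $ i) * (deriv F (of_real (norm (x - c))) / of_real (norm (x - c)))"
    and "(\<lambda>x. F (of_real (norm (x - c)))) differentiable (at x)"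
proof -
  have "(F has_field_derivative deriv F (of_real (norm (x - c)))) (at (of_real (norm (x - c))))"
    using x by (intro holomorphic_derivI[OF F]) auto
  from partial_deriv_field_compose[OF partial_deriv_norm(1)[OF x] this, of i]
    differentiable_field_compose[OF partial_deriv_norm(1)[OF x] this]
  show "partial_deriv i (\<lambda>x. F (of_real (norm (x - c)))) x
    = of_real ((x - c) $ i) * (deriv F (of_real (norm (x - c))) / of_real (norm (x - c)))"
    and "(\<lambda>x. F (of_real (norm (x - c)))) differentiable (at x)"
    by (simp_all add: partial_deriv_norm(2)[OF x] field_simps)
qed

lemma partial_deriv_coordinate:
  "partial_deriv i (\<lambda>x. complex_of_real ((x - c) $ j)) x = (if i = j then 1 else 0)"
  "(\<lambda>x. complex_of_real ((x - c) $ j)) differentiable (at x)"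
proof -
  have d: "((\<lambda>x. (x - c) $ j) has_derivative (\<lambda>h. h $ j)) (at x)"
    by (auto intro!: derivative_eq_intros bounded_linear_imp_has_derivative bounded_linear_vec_nth)
  show "partial_deriv i (\<lambda>x. complex_of_real ((x - c) $ j)) x = (if i = j then 1 else 0)"
    unfolding of_real_differentiable(2)[OF d] by (simp add: axis_def)
  show "(\<lambda>x. complex_of_real ((x - c) $ j)) differentiable (at x)"
    by (rule of_real_differentiable(1)[OF d])
qed

lemma hessian_radial:
  assumes F: "F holomorphic_on - {0}" and x: "x \<noteq> c"
  defines "K \<equiv> \<lambda>z. deriv F z / z" and "\<rho> \<equiv> complex_of_real (norm (x - c))"
  shows "partial_deriv i (partial_deriv j (\<lambda>x. F (of_real (norm (x - c))))) x
    = (if i = j then K \<rho> else 0) + of_real ((x - c) $ i) * of_real ((x - c) $ j) * (deriv K \<rho> / \<rho>)"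
proof -
  have K: "K holomorphic_on - {0}"
    unfolding K_def using F by (intro holomorphic_intros holomorphic_deriv) auto
  have "partial_deriv i (partial_deriv j (\<lambda>x. F (of_real (norm (x - c))))) x
    = partial_deriv i (\<lambda>x. of_real ((x - c) $ j) * K (of_real (norm (x - c)))) x"
    by (rule partial_deriv_cong[of "- {c}"]) (use x in \<open>auto simp: partial_deriv_radial[OF F] K_def\<close>)
  also have "\<dots> = (if i = j then K \<rho> else 0) + of_real ((x - c) $ i) * of_real ((x - c) $ j) * (deriv K \<rho> / \<rho>)"
    unfolding \<rho>_def
    by (subst partial_deriv_mult[OF partial_deriv_coordinate(2) partial_deriv_radial(2)[OF K x]])
      (simp add: partial_deriv_coordinate(1) partial_deriv_radial(1)[OF K x]
         del: vector_minus_component of_real_diff)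
  finally show ?thesis .
qed

text \<open>The electric field differentiates \<open>g(x,y)\<close> in its first argument, whereas integration by parts differentiates
  in the second. The Hessian of a radial function is a symmetric matrix and even in \<open>x - y\<close>, so the two
  agree.\<close>

lemma green_hessian_swap:
  assumes "x \<noteq> y"
  shows "partial_deriv i (partial_deriv j (\<lambda>z. green k z y)) x
    = partial_deriv j (partial_deriv i (green k x)) y"
proof -
  define F where "F = (\<lambda>z. exp (\<i> * of_real k * z) / (of_real (4 * pi) * z))"
  have F: "F holomorphic_on - {0}" unfolding F_def by (intro holomorphic_intros) auto
  have 1: "(\<lambda>z. green k z y) = (\<lambda>z. F (of_real (norm (z - y))))"
    by (simp add: green_def F_def mult.assoc)
  have 2: "green k x = (\<lambda>z. F (of_real (norm (z - x))))"
    by (rule ext) (simp add: green_def F_def mult.assoc norm_minus_commute)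
  have "of_real ((y - x) $ j) * of_real ((y - x) $ i) = of_real ((x - y) $ i) * complex_of_real ((x - y) $ j)"
    by (simp add: algebra_simps)
  then show ?thesis
    unfolding 1 2 hessian_radial[OF F assms] hessian_radial[OF F assms[symmetric]]
    by (simp only: norm_minus_commute[of y x]) auto
qed

lemma diff_upto_green: "diff_upto (- {c}) n (green k c)"
proof -
  have "diff_upto (- {c}) n (\<lambda>z. exp (\<i> * of_real k * of_real (norm (z - c))) * inverse (of_real (4 * pi) * of_real (norm (z - c))))"
    by (intro diff_upto_mult diff_upto_exp diff_upto_inverse diff_upto_const diff_upto_norm) auto
  also have "(\<lambda>z. exp (\<i> * of_real k * of_real (norm (z - c))) * inverse (of_real (4 * pi) * of_real (norm (z - c)))) = green k c"
    by (rule ext) (simp add: green_def norm_minus_commute field_simps)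
  finally show ?thesis .
qed

lemma diff_upto_plane_wave: "open S \<Longrightarrow> diff_upto S n (\<lambda>y. exp (- \<i> * of_real (\<xi> \<bullet> y)))"
  using diff_upto_inner[of S n \<xi> 0] by (intro diff_upto_exp diff_upto_mult diff_upto_const) auto

section \<open>Smooth cutoff functions\<close>

text \<open>The derivatives of \<open>e\<^sup>-\<^sup>1\<^sup>/\<^sup>t\<close> for \<open>t > 0\<close> have the form \<open>p(1/t) e\<^sup>-\<^sup>1\<^sup>/\<^sup>t\<close>. Differentiating once more
  replaces \<open>p\<close> by \<open>X\<^sup>2 (p - p')\<close>.\<close>

primrec flat_poly :: "nat \<Rightarrow> real poly" where
  "flat_poly 0 = 1"
| "flat_poly (Suc n) = monom 1 2 * (flat_poly n - pderiv (flat_poly n))"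

text \<open>The \<open>n\<close>-th derivative of the classical smooth function that is \<open>e\<^sup>-\<^sup>1\<^sup>/\<^sup>t\<close> for \<open>t > 0\<close> and zero
  otherwise.\<close>

definition flat :: "nat \<Rightarrow> real \<Rightarrow> real" where
  "flat n t = (if t \<le> 0 then 0 else poly (flat_poly n) (1 / t) * exp (- (1 / t)))"

lemma poly_times_exp_tendsto_0: "((\<lambda>s. poly p s * exp (- s)) \<longlongrightarrow> 0) at_top" for p :: "real poly"
proof -
  have "((\<lambda>s. \<Sum>i\<le>degree p. coeff p i * (s ^ i / exp s)) \<longlongrightarrow> 0) at_top"
    by (intro tendsto_null_sum tendsto_mult_right_zero tendsto_power_div_exp_0)
  then show ?thesis
    by (simp add: poly_altdef exp_minus sum_distrib_right divide_inverse mult.assoc)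
qed

lemma flat_has_derivative: "(flat n has_real_derivative flat (Suc n) t) (at t)"
proof -
  consider "t < 0" | "t > 0" | "t = 0" by linarith
  then show ?thesis
  proof cases
    case 1
    have "(flat n has_real_derivative 0) (at t)"
      by (rule has_field_derivative_transform_within_open[of "\<lambda>_. 0" _ _ "{..<0}"])
        (use 1 in \<open>auto simp: flat_def\<close>)
    then show ?thesis using 1 by (simp add: flat_def)
  next
    case 2
    have "((\<lambda>t. poly (flat_poly n) (1 / t) * exp (- (1 / t))) has_real_derivative flat (Suc n) t) (at t)"
      using 2 by (auto intro!: derivative_eq_intros DERIV_chain2[OF poly_DERIV]
          simp: flat_def poly_monom power2_eq_square field_simps)
    then show ?thesis
      by (rule has_field_derivative_transform_within_open[of _ _ _ "{0<..}"])
        (use 2 in \<open>auto simp: flat_def\<close>)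
  next
    case 3
    have "((\<lambda>s. poly (pCons 0 (flat_poly n)) s * exp (- s)) \<longlongrightarrow> 0) at_top"
      by (rule poly_times_exp_tendsto_0)
    then have "((\<lambda>h. poly (pCons 0 (flat_poly n)) (inverse h) * exp (- inverse h)) \<longlongrightarrow> 0) (at_right 0)"
      by (rule filterlim_compose[OF _ filterlim_inverse_at_top_right])
    then have right: "((\<lambda>h. (flat n (0 + h) - flat n 0) / h) \<longlongrightarrow> 0) (at_right 0)"
      by (rule Lim_transform_eventually)
        (auto simp: eventually_at_filter flat_def field_simps)
    have "((\<lambda>h::real. 0::real) \<longlongrightarrow> 0) (at_left 0)" by simp
    then have left: "((\<lambda>h. (flat n (0 + h) - flat n 0) / h) \<longlongrightarrow> 0) (at_left 0)"
      by (rule Lim_transform_eventually) (auto simp: eventually_at_filter flat_def)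
    have "((\<lambda>h. (flat n (0 + h) - flat n 0) / h) \<longlongrightarrow> 0) (at 0)"
      using left right by (simp add: filterlim_at_split)
    then show ?thesis
      unfolding 3 DERIV_def by (simp add: flat_def)
  qed
qed

lemma flat_nonneg: "flat 0 t \<ge> 0" and flat_pos_iff: "flat 0 t > 0 \<longleftrightarrow> t > 0"
  by (auto simp: flat_def)

lemma diff_upto_flat: "diff_upto UNIV n (\<lambda>x. of_real (flat m (\<alpha> + \<beta> * (x \<bullet> x))))"
proof (induction n arbitrary: m)
  have q: "((\<lambda>x. \<alpha> + \<beta> * (x \<bullet> x)) has_derivative (\<lambda>h. \<beta> * (2 * (x \<bullet> h)))) (at x)" for x :: "real^3"
    by (auto intro!: derivative_eq_intros simp: inner_commute)
  have d: "((\<lambda>x. flat m (\<alpha> + \<beta> * (x \<bullet> x))) has_derivative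
      (\<lambda>h. flat (Suc m) (\<alpha> + \<beta> * (x \<bullet> x)) * (\<beta> * (2 * (x \<bullet> h))))) (at x)" for m and x :: "real^3"
    using DERIV_compose_FDERIV[OF flat_has_derivative q, of m x] by (simp add: mult_ac)
  note dd = of_real_differentiable[OF d]
  {
    case 0
    then show ?case using dd(1) by simp
  next
    case (Suc n)
    show ?case
    proof (rule diff_upto_SucI[OF open_UNIV dd(1) dd(2)])
      show "diff_upto UNIV n (\<lambda>x. complex_of_real (flat (Suc m) (\<alpha> + \<beta> * (x \<bullet> x)) * (\<beta> * (2 * (x \<bullet> axis i 1)))))" for i
        using diff_upto_mult[OF open_UNIV Suc[of "Suc m"] diff_upto_mult[OF open_UNIV diff_upto_const[of _ _ "of_real (2 * \<beta>)"] diff_upto_inner[of UNIV n "axis i 1" 0]]]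
        by (simp add: inner_commute mult_ac)
    qed
  }
qed

definition cutoff :: "real \<Rightarrow> real \<Rightarrow> real^3 \<Rightarrow> real" where
  "cutoff a b x = flat 0 (b\<^sup>2 - x \<bullet> x) / (flat 0 (b\<^sup>2 - x \<bullet> x) + flat 0 (x \<bullet> x - a\<^sup>2))"

context
  fixes a b :: real
  assumes ab: "0 < a" "a < b"
begin

lemma cutoff_denominator_pos: "flat 0 (b\<^sup>2 - x \<bullet> x) + flat 0 (x \<bullet> x - a\<^sup>2) > 0" for x :: "real^3"
proof -
  have "a\<^sup>2 < b\<^sup>2" using ab by (simp add: power_strict_mono)
  then have "b\<^sup>2 - x \<bullet> x > 0 \<or> x \<bullet> x - a\<^sup>2 > 0" by linarith
  then show ?thesis
    using flat_nonneg flat_pos_iff by (metis add_nonneg_pos add_pos_nonneg)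
qed

lemma cutoff_range: "0 \<le> cutoff a b x" "cutoff a b x \<le> 1"
  using cutoff_denominator_pos[of x] flat_nonneg[of "x \<bullet> x - a\<^sup>2"] flat_nonneg[of "b\<^sup>2 - x \<bullet> x"]
  by (auto simp: cutoff_def divide_le_eq)

lemma cutoff_eq_1: "norm x \<le> a \<Longrightarrow> cutoff a b x = 1"
  using cutoff_denominator_pos[of x] ab power_mono[of "norm x" a 2]
  by (simp add: cutoff_def flat_def dot_square_norm split: if_splits)

lemma cutoff_eq_0: "norm x \<ge> b \<Longrightarrow> cutoff a b x = 0"
  using ab power_mono[of b "norm x" 2] by (simp add: cutoff_def flat_def dot_square_norm)

lemma diff_upto_cutoff: "diff_upto UNIV n (\<lambda>x. of_real (cutoff a b x))"
proof -
  have 1: "diff_upto UNIV n (\<lambda>x. of_real (flat 0 (b\<^sup>2 - x \<bullet> x)))"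
    using diff_upto_flat[of n 0 "b\<^sup>2" "-1"] by simp
  have 2: "diff_upto UNIV n (\<lambda>x. of_real (flat 0 (x \<bullet> x - a\<^sup>2)))"
    using diff_upto_flat[of n 0 "- a\<^sup>2" 1] by simp
  have nz: "complex_of_real (flat 0 (b\<^sup>2 - x \<bullet> x)) + of_real (flat 0 (x \<bullet> x - a\<^sup>2)) \<noteq> 0" for x :: "real^3"
    using cutoff_denominator_pos[of x] by (metis less_irrefl of_real_add of_real_eq_0_iff)
  show ?thesis
    using diff_upto_mult[OF open_UNIV 1 diff_upto_inverse[OF open_UNIV nz diff_upto_add[OF open_UNIV 1 2]]]
    by (simp add: cutoff_def divide_inverse)
qed

end

lemma cutoff_test_function:
  assumes ab: "0 < a" "a < b" "b < R" and S: "open S" "ball 0 R \<subseteq> S" and \<phi>: "\<And>n. diff_upto S n \<phi>"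
  shows "(\<lambda>x. of_real (cutoff a b x) * \<phi> x) \<in> test_functions (ball 0 R)"
    and "diff_upto UNIV n (\<lambda>x. of_real (cutoff a b x) * \<phi> x)"
proof -
  have diff_upto: "diff_upto UNIV n (\<lambda>x. of_real (cutoff a b x) * \<phi> x)" for n
  proof -
    have "diff_upto S n (\<lambda>x. of_real (cutoff a b x) * \<phi> x)"
      by (rule diff_upto_mult[OF S(1) diff_upto_subset[OF diff_upto_cutoff[OF ab(1,2)]] \<phi>]) simp
    moreover have "diff_upto (- cball 0 b) n (\<lambda>x. of_real (cutoff a b x) * \<phi> x)"
      by (rule diff_upto_cong[where f = "\<lambda>_. 0"]) (auto simp: cutoff_eq_0[OF ab(1,2)])
    ultimately have "diff_upto (S \<union> - cball 0 b) n (\<lambda>x. of_real (cutoff a b x) * \<phi> x)" by (rule diff_upto_Un)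
    moreover have "cball 0 b \<subseteq> ball (0::real^3) R" using ab by auto
    then have "S \<union> - cball 0 b = UNIV" using S(2) by blast
    ultimately show ?thesis by simp
  qed
  then show "diff_upto UNIV n (\<lambda>x. of_real (cutoff a b x) * \<phi> x)" .
  have sub: "closure {x. of_real (cutoff a b x) * \<phi> x \<noteq> 0} \<subseteq> cball 0 b"
    by (rule closure_minimal) (use cutoff_eq_0[OF ab(1,2)] in \<open>force simp: not_le\<close>)+
  moreover have "compact (closure {x. of_real (cutoff a b x) * \<phi> x \<noteq> 0})"
    using sub bounded_subset[OF bounded_cball] by (auto simp: compact_eq_bounded_closed)
  ultimately show "(\<lambda>x. of_real (cutoff a b x) * \<phi> x) \<in> test_functions (ball 0 R)"
    using ab smoothI[OF diff_upto] by (fastforce simp: test_functions_def)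
qed

section \<open>Square integrable fields and their supports\<close>

lemma integral_vec_component:
  fixes f :: "'a \<Rightarrow> complex^3"
  assumes "\<And>i. integrable M (\<lambda>x. f x $ i)"
  shows "integral\<^sup>L M f $ i = (LINT x|M. f x $ i)"
proof -
  have "linear (axis j :: complex \<Rightarrow> complex^3)" for j
    by (rule linearI) (auto simp: vec_eq_iff axis_def)
  then have "bounded_linear (axis j :: complex \<Rightarrow> complex^3)" for j
    by (simp add: linear_conv_bounded_linear)
  then have "integrable M (\<lambda>x. axis j (f x $ j) :: complex^3)" for j
    using assms by (rule integrable_bounded_linear)
  then have "integrable M (\<lambda>x. \<Sum>j\<in>UNIV. axis j (f x $ j) :: complex^3)"
    by (rule Bochner_Integration.integrable_sum)
  also have "(\<lambda>x. \<Sum>j\<in>UNIV. axis j (f x $ j) :: complex^3) = f"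
    by (simp add: vec_eq_iff fun_eq_iff axis_def)
  finally have "integrable M f" .
  from integral_bounded_linear[OF bounded_linear_vec_nth this, of i] show ?thesis by simp
qed

lemma L2_component_integrable:
  fixes f :: "real^3 \<Rightarrow> complex^3"
  assumes "f \<in> L2 (ball 0 R)"
  shows "integrable (lebesgue_on (ball 0 R)) (\<lambda>x. f x $ i)"
proof (rule Bochner_Integration.integrable_bound)
  have f: "f \<in> borel_measurable (lebesgue_on (ball 0 R))"
      "integrable (lebesgue_on (ball 0 R)) (\<lambda>x. (norm (f x))\<^sup>2)"
    using assms by (auto simp: L2_def)
  interpret finite_measure "lebesgue_on (ball (0::real^3) R)"
    by (rule finite_measure_lebesgue_on) simp
  show "integrable (lebesgue_on (ball 0 R)) (\<lambda>x. 1 + (norm (f x))\<^sup>2)"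
    using f(2) by (intro Bochner_Integration.integrable_add integrable_const)
  show "(\<lambda>x. f x $ i) \<in> borel_measurable (lebesgue_on (ball 0 R))"
    using f(1) by (rule measurable_compose)
      (intro borel_measurable_continuous_onI continuous_intros)
  have "norm (f x $ i) \<le> 1 + (norm (f x))\<^sup>2" for x
  proof -
    have "norm (f x $ i) \<le> norm (f x)" by (rule Finite_Cartesian_Product.norm_nth_le)
    also have "\<dots> \<le> 1 + (norm (f x))\<^sup>2"
      using zero_le_power2[of "norm (f x) - 1"] norm_ge_zero[of "f x"]
      unfolding power2_diff power_one by linarith
    finally show ?thesis .
  qed
  then show "AE x in lebesgue_on (ball 0 R). norm (f x $ i) \<le> norm (1 + (norm (f x))\<^sup>2)"
    by (intro AE_I2) (metis abs_ge_self order_trans real_norm_def)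
qed

text \<open>The complement of the support is covered by a possibly uncountable family of open sets; by Lindelof's theorem
  countably many of them suffice, so the exceptional null sets add up to a null set.\<close>

lemma AE_zero_outside_ess_support:
  "AE x in lebesgue. x \<in> \<Omega> - ess_support \<Omega> f \<longrightarrow> f x = 0"
proof -
  define U where "U = {V. open V \<and> (AE x in lebesgue. x \<in> \<Omega> \<inter> V \<longrightarrow> f x = 0)}"
  obtain V where V: "V \<subseteq> U" "countable V" "\<Union>V = \<Union>U"
    by (rule Lindelof[of U]) (auto simp: U_def)
  have "AE x in lebesgue. \<forall>W\<in>V. x \<in> \<Omega> \<inter> W \<longrightarrow> f x = 0"
    using V(1,2) by (subst AE_ball_countable) (auto simp: U_def)
  moreover have "\<Omega> - ess_support \<Omega> f \<subseteq> \<Union>V"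
    unfolding V(3) by (auto simp: ess_support_def U_def)
  ultimately show ?thesis by (auto elim!: eventually_mono)
qed

lemma compact_ess_support_radius:
  assumes "R > 0" "compact (ess_support (ball 0 R) f)" "ess_support (ball 0 R) f \<subseteq> ball 0 R"
  obtains r where "0 < r" "r < R" "AE x in lebesgue_on (ball 0 R). norm x \<ge> r \<longrightarrow> f x = 0"
proof -
  let ?K = "ess_support (ball 0 R) f"
  obtain r where r: "0 < r" "r < R" "?K \<subseteq> ball 0 r"
  proof (cases "?K = {}")
    case True
    then show thesis using assms(1) by (intro that[of "R / 2"]) auto
  next
    case False
    then obtain x where x: "x \<in> ?K" "\<And>y. y \<in> ?K \<Longrightarrow> norm y \<le> norm x"
      using continuous_attains_sup[OF assms(2) False, of norm] by (auto intro!: continuous_intros)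
    have "norm x < R" using x(1) assms(3) by auto
    moreover have "?K \<subseteq> ball 0 ((norm x + R) / 2)"
    proof
      fix y assume "y \<in> ?K"
      then show "y \<in> ball 0 ((norm x + R) / 2)" using x(2)[of y] \<open>norm x < R\<close> by simp
    qed
    moreover have "norm x + R > 0" using assms(1) norm_ge_zero[of x] by linarith
    ultimately show thesis by (intro that[of "(norm x + R) / 2"]) auto
  qed
  have "AE x in lebesgue. x \<in> ball 0 R \<longrightarrow> norm x \<ge> r \<longrightarrow> f x = 0"
    using AE_zero_outside_ess_support[of "ball 0 R" f] by eventually_elim (use r(3) in fastforce)
  then have "AE x in lebesgue_on (ball 0 R). norm x \<ge> r \<longrightarrow> f x = 0"
    by (subst AE_restrict_space_iff) auto
  with r show thesis by (intro that)
qed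

lemma lebesgue_on_ball_mono:
  fixes h :: "real^3 \<Rightarrow> complex"
  assumes "b \<le> R"
  shows "integrable (lebesgue_on (ball 0 R)) h \<Longrightarrow> integrable (lebesgue_on (ball 0 b)) h"
    and "(\<And>x. norm x \<ge> b \<Longrightarrow> h x = 0) \<Longrightarrow>
       (LINT x|lebesgue_on (ball 0 R). h x) = (LINT x|lebesgue_on (ball 0 b). h x)"
proof -
  have sub: "ball 0 b \<subseteq> ball (0::real^3) R" using assms by auto
  show "integrable (lebesgue_on (ball 0 b)) h" if "integrable (lebesgue_on (ball 0 R)) h"
  proof -
    have "set_integrable lebesgue (ball 0 R) h"
      using that unfolding set_integrable_def by (subst (asm) integrable_restrict_space) auto
    then have "set_integrable lebesgue (ball 0 b) h"
      by (rule set_integrable_subset) (use sub in auto)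
    then show ?thesis
      unfolding set_integrable_def by (subst integrable_restrict_space) auto
  qed
  show "(LINT x|lebesgue_on (ball 0 R). h x) = (LINT x|lebesgue_on (ball 0 b). h x)"
    if "\<And>x. norm x \<ge> b \<Longrightarrow> h x = 0"
  proof -
    have "(\<lambda>x. indicator (ball 0 R) x *\<^sub>R h x) = (\<lambda>x. indicator (ball 0 b) x *\<^sub>R h x)"
      using that sub by (fastforce simp: indicator_def fun_eq_iff not_less)
    then show ?thesis by (subst (1 2) integral_restrict_space) auto
  qed
qed

section \<open>Integration by parts for compactly supported sources\<close>

locale compact_source =
  fixes k R r :: real and J :: "real^3 \<Rightarrow> complex^3"
  assumes k: "k > 0" and r: "0 < r" "r < R" and J: "J \<in> H_div_grad (ball 0 R)"
    and J_zero: "AE x in lebesgue_on (ball 0 R). norm x \<ge> r \<longrightarrow> J x = 0"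
begin

abbreviation M :: "(real^3) measure" where "M \<equiv> lebesgue_on (ball 0 R)"

definition F :: "real^3 \<Rightarrow> complex^3" where "F = grad_div (ball 0 R) J"

lemma F: "F \<in> L2 (ball 0 R)" "is_grad_div (ball 0 R) J F"
proof -
  have "\<exists>F. F \<in> L2 (ball 0 R) \<and> is_grad_div (ball 0 R) J F"
    using J by (auto simp: H_div_grad_def)
  from someI_ex[OF this] show "F \<in> L2 (ball 0 R)" "is_grad_div (ball 0 R) J F"
    by (simp_all add: F_def grad_div_def)
qed

lemma J_integrable: "integrable M (\<lambda>x. J x $ i)"
  using J by (intro L2_component_integrable) (auto simp: H_div_grad_def)

lemma F_integrable: "integrable M (\<lambda>x. F x $ i)"
  by (rule L2_component_integrable[OF F(1)])

lemma modified_source_component: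
  "modified_source k R J x $ i = J x $ i + (1 / k\<^sup>2) *\<^sub>R F x $ i"
  by (simp add: modified_source_def F_def)

lemma modified_source_integrable: "integrable M (\<lambda>x. modified_source k R J x $ i)"
  unfolding modified_source_component
  by (intro Bochner_Integration.integrable_add J_integrable integrable_scaleR_right F_integrable)

lemma integrable_mult_continuous:
  assumes u: "integrable M u" and v: "continuous_on UNIV v"
  shows "integrable M (\<lambda>x. u x * v x :: complex)"
proof -
  have "compact (v ` cball 0 R)"
    using v by (intro compact_continuous_image) (auto intro: continuous_on_subset)
  then have "bounded (v ` cball 0 R)" by (rule compact_imp_bounded)
  then obtain C where "\<forall>z\<in>v ` cball 0 R. norm z \<le> C"
    unfolding bounded_iff by blast
  then have C: "norm (v x) \<le> C" if "x \<in> cball 0 R" for x using that by blast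
  show ?thesis
  proof (rule Bochner_Integration.integrable_bound)
    show "integrable M (\<lambda>x. norm (u x) * C)" using u by auto
    show "(\<lambda>x. u x * v x) \<in> borel_measurable M"
      by (intro borel_measurable_times borel_measurable_integrable[OF u]
          continuous_imp_measurable_on_sets_lebesgue continuous_on_subset[OF v]) auto
    have "norm (u x * v x) \<le> norm (norm (u x) * C)" if "x \<in> space M" for x
    proof -
      have "norm (v x) \<le> \<bar>C\<bar>" using C[of x] that by simp
      then show ?thesis by (simp add: norm_mult abs_mult mult_left_mono)
    qed
    then show "AE x in M. norm (u x * v x) \<le> norm (norm (u x) * C)" by (rule AE_I2)
  qed
qed

lemma integral_J_cong:
  assumes "integrable M (\<lambda>x. J x $ j * u x)" and "\<And>x. norm x < r \<Longrightarrow> u x = v x"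
    and "continuous_on (ball 0 R) v"
  shows "integrable M (\<lambda>x. J x $ j * v x)"
    and "(LINT x|M. J x $ j * v x) = (LINT x|M. J x $ j * u x)"
proof -
  have meas: "(\<lambda>x. J x $ j * v x) \<in> borel_measurable M"
    by (intro borel_measurable_times borel_measurable_integrable[OF J_integrable]
        continuous_imp_measurable_on_sets_lebesgue assms(3)) auto
  have ae: "AE x in M. J x $ j * u x = J x $ j * v x"
    using J_zero by eventually_elim (use assms(2) in \<open>force simp: not_le\<close>)
  show "integrable M (\<lambda>x. J x $ j * v x)"
    by (rule integrable_cong_AE_imp[OF assms(1) meas]) (use ae in \<open>auto elim: eventually_mono\<close>)
  show "(LINT x|M. J x $ j * v x) = (LINT x|M. J x $ j * u x)"
    by (rule integral_cong_AE) (use ae assms(1) meas in \<open>auto elim: eventually_mono\<close>)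
qed

lemma diff_upto_continuous: "diff_upto S n f \<Longrightarrow> T \<subseteq> S \<Longrightarrow> continuous_on T f"
  by (meson diff_upto_differentiable continuous_at_imp_continuous_on differentiable_imp_continuous_within subsetD)

text \<open>The right-hand side depends neither on \<open>a\<close> nor on \<open>b\<close>: where \<open>J\<close> lives, the cutoff is \<open>1\<close> on an
  open set, and the second derivatives of the product are those of \<open>\<phi>\<close>. The kernel \<open>\<phi>\<close> may be singular on
  the boundary of the ball, as Green's function is for \<open>|c| = R\<close>.\<close>

lemma grad_div_pairing:
  assumes ab: "r \<le> a" "a < b" "b < R" and S: "open S" "ball 0 R \<subseteq> S" and \<phi>: "\<And>n. diff_upto S n \<phi>"
  shows "integrable M (\<lambda>x. J x $ j * partial_deriv j (partial_deriv i \<phi>) x)"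
    and "(LINT x|M. F x $ i * (of_real (cutoff a b x) * \<phi> x))
      = (\<Sum>j\<in>UNIV. LINT x|M. J x $ j * partial_deriv j (partial_deriv i \<phi>) x)"
    and "integrable M (\<lambda>x. J x $ i * \<phi> x)"
    and "(LINT x|M. J x $ i * \<phi> x) = (LINT x|M. J x $ i * (of_real (cutoff a b x) * \<phi> x))"
proof -
  define \<psi> where "\<psi> = (\<lambda>x. of_real (cutoff a b x) * \<phi> x)"
  have a: "0 < a" using ab r by simp
  have \<psi>: "\<psi> \<in> test_functions (ball 0 R)" "diff_upto UNIV n \<psi>" for n
    unfolding \<psi>_def using cutoff_test_function[OF a ab(2,3) S \<phi>] by auto
  have eq0: "\<psi> x = \<phi> x" if "norm x < r" for x
    using that ab cutoff_eq_1[OF a ab(2), of x] by (simp add: \<psi>_def)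
  have eq1: "partial_deriv i \<psi> x = partial_deriv i \<phi> x" if "norm x < r" for x i
    by (rule partial_deriv_cong[of "ball 0 r"]) (use that eq0 in auto)
  have eq2: "partial_deriv j (partial_deriv i \<psi>) x = partial_deriv j (partial_deriv i \<phi>) x"
    if "norm x < r" for x i j
    by (rule partial_deriv_cong[of "ball 0 r"]) (use that eq1 in auto)
  have ck2: "diff_upto S 0 (partial_deriv j (partial_deriv i \<phi>))" "diff_upto UNIV 0 (partial_deriv j (partial_deriv i \<psi>))" for i j
    using \<phi>[of "Suc (Suc 0)"] \<psi>(2)[of "Suc (Suc 0)"] by (simp_all del: diff_upto.simps(1))
  have int2: "integrable M (\<lambda>x. J x $ j * partial_deriv j (partial_deriv i \<psi>) x)" for i j
    by (intro integrable_mult_continuous J_integrable diff_upto_continuous[OF ck2(2)]) auto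
  note c2 = integral_J_cong[OF int2 eq2 diff_upto_continuous[OF ck2(1) S(2)]]
  show "integrable M (\<lambda>x. J x $ j * partial_deriv j (partial_deriv i \<phi>) x)"
    by (rule c2(1)) auto
  have "(LINT x|M. F x $ i * \<psi> x) = (LINT x|M. (\<Sum>j\<in>UNIV. J x $ j * partial_deriv j (partial_deriv i \<psi>) x))"
    using F(2) \<psi>(1) by (simp add: is_grad_div_def distr_grad_def distr_div_def)
  also have "\<dots> = (\<Sum>j\<in>UNIV. LINT x|M. J x $ j * partial_deriv j (partial_deriv i \<psi>) x)"
    by (intro Bochner_Integration.integral_sum int2)
  also have "\<dots> = (\<Sum>j\<in>UNIV. LINT x|M. J x $ j * partial_deriv j (partial_deriv i \<phi>) x)"
    using c2(2) by (intro sum.cong) auto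
  finally show "(LINT x|M. F x $ i * (of_real (cutoff a b x) * \<phi> x))
      = (\<Sum>j\<in>UNIV. LINT x|M. J x $ j * partial_deriv j (partial_deriv i \<phi>) x)"
    by (simp add: \<psi>_def)
  have int0: "integrable M (\<lambda>x. J x $ i * \<psi> x)"
    by (intro integrable_mult_continuous J_integrable diff_upto_continuous[OF \<psi>(2)]) auto
  note c0 = integral_J_cong[OF int0 eq0 diff_upto_continuous[OF \<phi> S(2)]]
  show "integrable M (\<lambda>x. J x $ i * \<phi> x)" by (rule c0(1)) auto
  have "(LINT x|M. J x $ i * \<phi> x) = (LINT x|M. J x $ i * \<psi> x)" by (rule c0(2)) auto
  then show "(LINT x|M. J x $ i * \<phi> x) = (LINT x|M. J x $ i * (of_real (cutoff a b x) * \<phi> x))"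
    by (simp add: \<psi>_def)
qed

text \<open>The cutoff makes Green's function with centre on the boundary an admissible kernel, and leaves
  a function that vanishes outside a strictly smaller ball.\<close>

definition localized :: "3 \<Rightarrow> real^3 \<Rightarrow> complex" where
  "localized i x = of_real (cutoff r ((r + R) / 2) x) * modified_source k R J x $ i"

lemma cutoff_radii: "r < (r + R) / 2" "(r + R) / 2 < R"
  using r by auto

lemma localized_integrable: "integrable M (localized i)"
proof -
  have "integrable M (\<lambda>x. modified_source k R J x $ i * of_real (cutoff r ((r + R) / 2) x))"
    by (intro integrable_mult_continuous modified_source_integrable diff_upto_continuous[OF diff_upto_cutoff])
      (use r in auto)
  then show ?thesis by (simp add: localized_def[abs_def] mult.commute)
qed

lemma localized_eq_0: "norm x \<ge> (r + R) / 2 \<Longrightarrow> localized i x = 0"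
  using cutoff_eq_0[OF r(1) cutoff_radii(1)] by (simp add: localized_def)

text \<open>The right-hand side involves \<open>J\<close> only, through kernels derived from \<open>\<phi>\<close>; both the electric field and the
  Fourier transform are instances of it.\<close>

lemma integral_localized:
  assumes S: "open S" "ball 0 R \<subseteq> S" and \<phi>: "\<And>n. diff_upto S n \<phi>"
  shows "(LINT x|M. \<phi> x * localized i x) = (LINT x|M. J x $ i * \<phi> x)
    + (1 / k\<^sup>2) *\<^sub>R (\<Sum>j\<in>UNIV. LINT x|M. J x $ j * partial_deriv j (partial_deriv i \<phi>) x)"
proof -
  let ?\<chi> = "\<lambda>x. of_real (cutoff r ((r + R) / 2) x)"
  note p = grad_div_pairing[OF order_refl cutoff_radii S \<phi>]
  have cont: "continuous_on UNIV (\<lambda>x. ?\<chi> x * \<phi> x)"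
    by (rule diff_upto_continuous[OF cutoff_test_function(2)[OF r(1) cutoff_radii S \<phi>]]) auto
  have "(LINT x|M. \<phi> x * localized i x)
    = (LINT x|M. J x $ i * (?\<chi> x * \<phi> x) + (1 / k\<^sup>2) *\<^sub>R (F x $ i * (?\<chi> x * \<phi> x)))"
    by (simp add: localized_def modified_source_component algebra_simps)
  also have "\<dots> = (LINT x|M. J x $ i * (?\<chi> x * \<phi> x)) + (1 / k\<^sup>2) *\<^sub>R (LINT x|M. F x $ i * (?\<chi> x * \<phi> x))"
    by (subst Bochner_Integration.integral_add)
      (auto intro!: integrable_mult_continuous J_integrable F_integrable cont integrable_scaleR_right)
  finally show ?thesis
    using p(2,4)[of i] by simp
qed

lemma electric_field_component:
  assumes c: "c \<notin> ball 0 R"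
  shows "electric_field k R J c $ i = (LINT y|M. green k c y * localized i y)"
proof -
  have S: "open (- {c})" "ball 0 R \<subseteq> - {c}" using c by auto
  note p = grad_div_pairing[OF order_refl cutoff_radii S diff_upto_green[of c _ k]]
  have entry: "(green_tensor k c y *v J y) $ i = J y $ i * green k c y
      + (1 / k\<^sup>2) *\<^sub>R (\<Sum>j\<in>UNIV. J y $ j * partial_deriv j (partial_deriv i (green k c)) y)"
    if "y \<in> space M" for y i
  proof -
    have "c \<noteq> y" using c that by auto
    then show ?thesis
      by (simp add: green_tensor_def hessian_def matrix_vector_mult_def mat_def green_hessian_swap
          distrib_right sum.distrib if_distrib[of "\<lambda>z. z * _"] cong: if_cong)
        (simp add: mult.commute scaleR_sum_right)
  qed
  have int: "integrable M (\<lambda>y. J y $ i * green k c y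
      + (1 / k\<^sup>2) *\<^sub>R (\<Sum>j\<in>UNIV. J y $ j * partial_deriv j (partial_deriv i (green k c)) y))" for i
    by (intro Bochner_Integration.integrable_add p integrable_scaleR_right Bochner_Integration.integrable_sum)
  have "electric_field k R J c $ i = (LINT y|M. (green_tensor k c y *v J y) $ i)"
    unfolding electric_field_def
  proof (rule integral_vec_component)
    show "integrable M (\<lambda>y. (green_tensor k c y *v J y) $ i)" for i
      using int[of i] by (rule Bochner_Integration.integrable_cong[THEN iffD2, rotated 2]) (simp_all add: entry del: space_lebesgue_on space_restrict_space)
  qed
  also have "\<dots> = (LINT y|M. J y $ i * green k c y
      + (1 / k\<^sup>2) *\<^sub>R (\<Sum>j\<in>UNIV. J y $ j * partial_deriv j (partial_deriv i (green k c)) y))"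
    by (rule Bochner_Integration.integral_cong) (simp_all add: entry del: space_lebesgue_on space_restrict_space)
  also have "\<dots> = (LINT y|M. J y $ i * green k c y)
      + (1 / k\<^sup>2) *\<^sub>R (\<Sum>j\<in>UNIV. LINT y|M. J y $ j * partial_deriv j (partial_deriv i (green k c)) y)"
    by (simp add: p integrable_scaleR_right Bochner_Integration.integrable_sum)
  finally show ?thesis
    unfolding integral_localized[OF S diff_upto_green] .
qed

text \<open>The Fourier transform is defined without a cutoff. Cutoffs that exhaust the ball give integrals that
  do not depend on the cutoff, by \<open>grad_div_pairing\<close>, and converge to the full integral. In effect,
  \<open>\<nabla>(\<nabla>\<cdot>J)\<close> contributes nothing outside the support of \<open>J\<close>.\<close>

lemma integral_grad_div_cutoff:
  assumes \<phi>: "\<And>n. diff_upto UNIV n \<phi>"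
  shows "(LINT x|M. F x $ i * \<phi> x)
    = (LINT x|M. F x $ i * (of_real (cutoff r ((r + R) / 2) x) * \<phi> x))"
proof -
  define a where "a = (\<lambda>n. R - (R - r) / (real n + 2))"
  define b where "b = (\<lambda>n. R - (R - r) / (real n + 3))"
  have ab: "r \<le> a n" "a n < b n" "b n < R" "0 < a n" for n
  proof -
    have "(R - r) / (real n + 2) \<le> (R - r) / 1" using r by (intro divide_left_mono) auto
    then show "r \<le> a n" by (simp add: a_def)
    then show "0 < a n" using r by simp
    have "(R - r) / (real n + 3) < (R - r) / (real n + 2)" using r by (intro divide_strict_left_mono) auto
    then show "a n < b n" by (simp add: a_def b_def)
    show "b n < R" using r by (simp add: b_def)
  qed
  have "(LINT x|M. F x $ i * (of_real (cutoff (a n) (b n) x) * \<phi> x))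
      = (LINT x|M. F x $ i * (of_real (cutoff r ((r + R) / 2) x) * \<phi> x))" for n
    using grad_div_pairing(2)[OF ab(1-3) open_UNIV subset_UNIV \<phi>]
      grad_div_pairing(2)[OF order_refl cutoff_radii open_UNIV subset_UNIV \<phi>] by simp
  moreover have "(\<lambda>n. LINT x|M. F x $ i * (of_real (cutoff (a n) (b n) x) * \<phi> x)) \<longlonglongrightarrow> (LINT x|M. F x $ i * \<phi> x)"
  proof (rule integral_dominated_convergence[where w = "\<lambda>x. norm (F x $ i * \<phi> x)"])
    have int: "integrable M (\<lambda>x. F x $ i * \<phi> x)"
      by (intro integrable_mult_continuous F_integrable diff_upto_continuous[OF \<phi>]) auto
    then show "(\<lambda>x. F x $ i * \<phi> x) \<in> borel_measurable M" "integrable M (\<lambda>x. norm (F x $ i * \<phi> x))" by auto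
    show "(\<lambda>x. F x $ i * (of_real (cutoff (a n) (b n) x) * \<phi> x)) \<in> borel_measurable M" for n
      by (intro borel_measurable_integrable integrable_mult_continuous F_integrable
          diff_upto_continuous[OF diff_upto_mult[OF open_UNIV diff_upto_cutoff[OF ab(4) ab(2)] \<phi>]]) auto
    show "AE x in M. norm (F x $ i * (of_real (cutoff (a n) (b n) x) * \<phi> x)) \<le> norm (F x $ i * \<phi> x)" for n
    proof (rule AE_I2)
      fix x
      have "\<bar>cutoff (a n) (b n) x\<bar> \<le> 1" using cutoff_range[OF ab(4) ab(2), of n x] by simp
      then have "norm (F x $ i) * (\<bar>cutoff (a n) (b n) x\<bar> * norm (\<phi> x)) \<le> norm (F x $ i) * (1 * norm (\<phi> x))"
        by (intro mult_left_mono mult_right_mono) auto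
      then show "norm (F x $ i * (of_real (cutoff (a n) (b n) x) * \<phi> x)) \<le> norm (F x $ i * \<phi> x)"
        by (simp add: norm_mult)
    qed
    show "AE x in M. (\<lambda>n. F x $ i * (of_real (cutoff (a n) (b n) x) * \<phi> x)) \<longlonglongrightarrow> F x $ i * \<phi> x"
    proof (rule AE_I2)
      fix x assume "x \<in> space M"
      then have x: "norm x < R" by simp
      have "a \<longlonglongrightarrow> R" unfolding a_def by real_asymp
      then have "eventually (\<lambda>n. norm x < a n) sequentially" using x by (rule order_tendstoD)
      then have "eventually (\<lambda>n. F x $ i * \<phi> x = F x $ i * (of_real (cutoff (a n) (b n) x) * \<phi> x)) sequentially"
        by eventually_elim (simp add: cutoff_eq_1[OF ab(4) ab(2)])
      then show "(\<lambda>n. F x $ i * (of_real (cutoff (a n) (b n) x) * \<phi> x)) \<longlonglongrightarrow> F x $ i * \<phi> x"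
        by (rule Lim_transform_eventually[OF tendsto_const])
    qed
  qed
  ultimately show ?thesis using LIMSEQ_unique[OF _ tendsto_const] by simp
qed

lemma fourier_component:
  "fourier_ball R (modified_source k R J) \<xi> $ i
    = (LINT x|M. exp (- \<i> * of_real (\<xi> \<bullet> x)) * localized i x)"
proof -
  define e where "e = (\<lambda>x. exp (- \<i> * of_real (\<xi> \<bullet> x)))"
  have e: "diff_upto UNIV n e" for n unfolding e_def by (rule diff_upto_plane_wave) simp
  have cont: "continuous_on UNIV e" by (rule diff_upto_continuous[OF e]) simp
  have int: "integrable M (\<lambda>x. (e x *s modified_source k R J x) $ i)" for i
    using integrable_mult_continuous[OF modified_source_integrable cont] by (simp add: mult.commute)
  have "fourier_ball R (modified_source k R J) \<xi> $ i = (LINT x|M. (e x *s modified_source k R J x) $ i)"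
    unfolding fourier_ball_def e_def[symmetric] using integral_vec_component[OF int] by (simp add: e_def)
  also have "\<dots> = (LINT x|M. J x $ i * e x + (1 / k\<^sup>2) *\<^sub>R (F x $ i * e x))"
    by (simp add: modified_source_component algebra_simps)
  also have "\<dots> = (LINT x|M. J x $ i * e x) + (1 / k\<^sup>2) *\<^sub>R (LINT x|M. F x $ i * e x)"
    by (subst Bochner_Integration.integral_add)
      (auto intro!: integrable_mult_continuous J_integrable F_integrable cont integrable_scaleR_right)
  also have "(LINT x|M. F x $ i * e x) = (\<Sum>j\<in>UNIV. LINT x|M. J x $ j * partial_deriv j (partial_deriv i e) x)"
    unfolding integral_grad_div_cutoff[OF e]
    by (rule grad_div_pairing(2)[OF order_refl cutoff_radii open_UNIV subset_UNIV e])
  also have "(LINT x|M. J x $ i * e x) + (1 / k\<^sup>2) *\<^sub>R \<dots> = (LINT x|M. e x * localized i x)"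
    by (rule integral_localized[OF open_UNIV subset_UNIV e, symmetric])
  finally show ?thesis unfolding e_def .
qed

section \<open>Nonradiating sources\<close>

lemma nonradiating_iff:
  "nonradiating k R J \<longleftrightarrow> (\<forall>\<xi>. norm \<xi> = k \<longrightarrow> fourier_ball R (modified_source k R J) \<xi> = 0)"
proof
  assume nr: "nonradiating k R J"
  have R: "R > 0" using r by simp
  have "(LINT y|M. green k x y * localized i y) = 0" if "norm x > R" for x i
    using nr that electric_field_component[of x i] by (simp add: nonradiating_def)
  from Fourier_zero_if_outgoing_field_zero[OF localized_integrable k R this]
  show "\<forall>\<xi>. norm \<xi> = k \<longrightarrow> fourier_ball R (modified_source k R J) \<xi> = 0"
    by (simp add: vec_eq_iff fourier_component)
next
  assume fz: "\<forall>\<xi>. norm \<xi> = k \<longrightarrow> fourier_ball R (modified_source k R J) \<xi> = 0"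
  \<comment> \<open>Working in a smaller ball places the points with \<open>|x| = R\<close> strictly outside, as the expansion requires.\<close>
  define b where "b = (r + R) / 2"
  have b: "b > 0" "b < R" using r by (auto simp: b_def)
  have shrink: "(LINT x|lebesgue_on (ball 0 b). h x * localized i x) = (LINT x|M. h x * localized i x)" for h i
    using lebesgue_on_ball_mono(2)[of b R "\<lambda>x. h x * localized i x"] b localized_eq_0 by (simp add: b_def)
  have fz': "(LINT x|lebesgue_on (ball 0 b). exp (- \<i> * of_real (\<xi> \<bullet> x)) * localized i x) = 0"
    if "norm \<xi> = k" for \<xi> i
    unfolding shrink using fz that fourier_component[of \<xi> i] by simp
  have "electric_field k R J x $ i = 0" if "x \<notin> ball 0 R" for x i
  proof -
    have "(LINT y|lebesgue_on (ball 0 b). green k x y * localized i y) = 0"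
      by (rule outgoing_field_zero_if_Fourier_zero[OF lebesgue_on_ball_mono(1)[OF _ localized_integrable] k b(1) fz'])
        (use that b in auto)
    then show ?thesis unfolding shrink electric_field_component[OF that] .
  qed
  then show "nonradiating k R J"
    by (simp add: nonradiating_def vec_eq_iff)
qed

end

theorem theorem3p5:
  fixes \<kappa> R :: real and J :: "real^3 \<Rightarrow> complex^3"
  assumes "\<kappa> > 0" and "R > 0"
    and "J \<in> H_div_grad (ball 0 R)"
    and "compact (ess_support (ball 0 R) J)" and "ess_support (ball 0 R) J \<subseteq> ball 0 R"
  shows "nonradiating \<kappa> R J \<longleftrightarrow>
    (\<forall>\<xi>. norm \<xi> = \<kappa> \<longrightarrow> fourier_ball R (modified_source \<kappa> R J) \<xi> = 0)"
proof -
  obtain r where "0 < r" "r < R" "AE x in lebesgue_on (ball 0 R). norm x \<ge> r \<longrightarrow> J x = 0"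
    using assms(2,4,5) by (rule compact_ess_support_radius)
  then interpret compact_source \<kappa> R r J
    using assms by unfold_locales
  show ?thesis by (rule nonradiating_iff)
qed

end
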